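(* Let $\mathcal{D}$ be a triangulated category with shift functor $[1]$. Let $(\mathcal{U}_1,\mathcal{V}_1)$ and $(\mathcal{U}_2,\mathcal{V}_2)$ be two torsion pairs in $\mathcal{D}$ such that $(\mathcal{U}_1,\mathcal{V}_1)\preccurlyeq(\mathcal{U}_2,\mathcal{V}_2)$. Let $(\mathcal{C}_1^{\leqslant 0},\mathcal{C}_1^{\geqslant 0})$ and $(\mathcal{C}_2^{\leqslant 0},\mathcal{C}_2^{\geqslant 0})$ be two $t$-structures on $\mathcal{D}$ such that $\mathcal{C}_1^{\leqslant 0}\subseteq\mathcal{C}_2^{\leqslant 0}$. Then there are order preserving, mutually inverse bijections (1) between the set of torsion pairs $(\mathcal{U},\mathcal{V})$ in $\mathcal{D}$ with $(\mathcal{U}_1,\mathcal{V}_1)\preccurlyeq(\mathcal{U},\mathcal{V})\preccurlyeq(\mathcal{U}_2,\mathcal{V}_2)$ and the set of torsion pairs $(\mathcal{T},\mathcal{F})$ in $\mathcal{U}_2\cap\mathcal{V}_1$ with $\mathcal{T}[1]\subseteq\mathcal{U}_2$ and $\mathcal{F}[-1]\subseteq\mathcal{V}_1$; (2) between the poset of $t$-structures $(\mathcal{D}^{\leqslant 0},\mathcal{D}^{\geqslant 0})$ on $\mathcal{D}$ with $\mathcal{U}_1\subseteq\mathcal{D}^{\leqslant 0}\subseteq\mathcal{U}_2$ and the poset of $s$-torsion pairs $(\mathcal{T},\mathcal{F})$ in $\mathcal{U}_2\cap\mathcal{V}_1$ with $\mathcal{T}[1]\subseteq\mathcal{U}_2$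 and $\mathcal{F}[-1]\subseteq\mathcal{V}_1$; (3) between the set of torsion pairs $(\mathcal{U},\mathcal{V})$ in $\mathcal{D}$ with $\mathcal{C}_1^{\leqslant 0}\subseteq\mathcal{U}\subseteq\mathcal{C}_2^{\leqslant 0}$ and the set of torsion pairs in $\mathcal{C}_2^{\leqslant 0}\cap\mathcal{C}_1^{\geqslant 1}$; (4) between the poset of $t$-structures $(\mathcal{D}^{\leqslant 0},\mathcal{D}^{\geqslant 0})$ on $\mathcal{D}$ with $\mathcal{C}_1^{\leqslant 0}\subseteq\mathcal{D}^{\leqslant 0}\subseteq\mathcal{C}_2^{\leqslant 0}$ and the poset of $s$-torsion pairs in $\mathcal{C}_2^{\leqslant 0}\cap\mathcal{C}_1^{\geqslant 1}$.
   Context: All categories are skeletally small; all subcategories are full and closed under isomorphisms. For subcategories $\mathcal{X},\mathcal{Y}$ of $\mathcal{D}$, $\mathcal{X}*\mathcal{Y}$ is the subcategory of objects $A$ admitting a distinguished triangle $X\to A\to Y\to X[1]$ with $X\in\mathcal{X}$, $Y\in\mathcal{Y}$. Let $\mathcal{K}$ be $\mathcal{D}$ or an extension-closed subcategory of $\mathcal{D}$ (such as $\mathcal{U}_2\cap\mathcal{V}_1$). It is an extriangulated category whose $\mathbb{E}$-triangles are the distinguished triangles $A\to B\to C\to A[1]$ of $\mathcal{D}$ with $A,B,C\in\mathcal{K}$, with negative first extension $\mathbb{E}^{-1}(-,-)=\mathcal{D}(-,-[-1])$. A torsion pair in $\mathcal{K}$ is a pair $(\mathcal{T},\mathcal{F})$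 of additive subcategories of $\mathcal{K}$ closed under direct sums and direct summands with $\mathcal{D}(\mathcal{T},\mathcal{F})=0$ and such that every object $X\in\mathcal{K}$ admits a distinguished triangle $T\to X\to F\to T[1]$ with $T\in\mathcal{T}$, $F\in\mathcal{F}$. It is an $s$-torsion pair if moreover $\mathcal{D}(\mathcal{T},\mathcal{F}[-1])=0$. For torsion pairs in $\mathcal{K}$, $(\mathcal{T}_1,\mathcal{F}_1)\preccurlyeq(\mathcal{T}_2,\mathcal{F}_2)$ means $\mathcal{D}(\mathcal{T}_1,\mathcal{F}_2)=0$ and $\mathcal{D}(\mathcal{T}_1,\mathcal{F}_2[-1])=0$. For $\mathcal{K}=\mathcal{D}$, $(\mathcal{U}_1,\mathcal{V}_1)\preccurlyeq(\mathcal{U}_2,\mathcal{V}_2)$ iff $\mathcal{U}_1\subseteq\mathcal{U}_2$ and $\mathcal{U}_1[1]\subseteq\mathcal{U}_2$. The relation $\preccurlyeq$ is transitive but not necessarily reflexive; on $s$-torsion pairs it is the partial order given by inclusion of torsion classes (first components). A $t$-structure on $\mathcal{D}$ is a pair $(\mathcal{D}^{\leqslant 0},\mathcal{D}^{\geqslant 0})$ of subcategories such that, writing $\mathcal{D}^{\leqslant n}=\mathcal{D}^{\leqslant 0}[-n]$, $\mathcal{D}^{\geqslant n}=\mathcal{D}^{\geqslant 0}[-n]$: $\mathcal{D}(\mathcal{D}^{\leqslant 0},\mathcal{D}^{\geqslant 1})=0$, $\mathcal{D}=\mathcal{D}^{\leqslant 0}*\mathcal{D}^{\geqslant 1}$,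 $\mathcal{D}^{\leqslant 0}\subseteq\mathcal{D}^{\leqslant 1}$ and $\mathcal{D}^{\geqslant 1}\subseteq\mathcal{D}^{\geqslant 0}$. The same notation $\mathcal{C}_i^{\geqslant 1}=\mathcal{C}_i^{\geqslant 0}[-1]$ is used. $t$-structures are ordered by inclusion of the aisles $\mathcal{D}^{\leqslant 0}$; order preserving for sets of torsion pairs means preserving $\preccurlyeq$. *)

theory Defs
  imports "HOL-Algebra.Group"
begin

section \<open>Additive categories\<close>

text \<open>
  Categories are small: objects and arrows form sets, and an arrow determines its domain and
  codomain. Composition is written in applicative order, so \<open>g \<cdot> f\<close> means \<open>f\<close> first.
\<close>

record ('o, 'm) category_data =
  Obj :: "'o set"
  Arr :: "'m set"
  Dom :: "'m \<Rightarrow> 'o"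
  Cod :: "'m \<Rightarrow> 'o"
  Id :: "'o \<Rightarrow> 'm"
  Comp :: "'m \<Rightarrow> 'm \<Rightarrow> 'm"  (infixr "\<cdot>\<index>" 70)

definition Hom :: "('o, 'm, 'x) category_data_scheme \<Rightarrow> 'o \<Rightarrow> 'o \<Rightarrow> 'm set" where
  "Hom C A B = {f \<in> Arr C. Dom C f = A \<and> Cod C f = B}"

locale category =
  fixes C :: "('o, 'm, 'x) category_data_scheme" (structure)
  assumes Dom_in_Obj: "f \<in> Arr C \<Longrightarrow> Dom C f \<in> Obj C"
    and Cod_in_Obj: "f \<in> Arr C \<Longrightarrow> Cod C f \<in> Obj C"
    and Id_in_Hom: "X \<in> Obj C \<Longrightarrow> Id C X \<in> Hom C X X"
    and Comp_in_Hom: "\<lbrakk>f \<in> Hom C X Y; g \<in> Hom C Y Z\<rbrakk> \<Longrightarrow> g \<cdot> f \<in> Hom C X Z"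
    and Comp_Id_right: "f \<in> Hom C X Y \<Longrightarrow> f \<cdot> Id C X = f"
    and Comp_Id_left: "f \<in> Hom C X Y \<Longrightarrow> Id C Y \<cdot> f = f"
    and Comp_assoc: "\<lbrakk>f \<in> Hom C W X; g \<in> Hom C X Y; h \<in> Hom C Y Z\<rbrakk>
      \<Longrightarrow> (h \<cdot> g) \<cdot> f = h \<cdot> (g \<cdot> f)"

definition inverse_arrows ::
  "('o, 'm, 'x) category_data_scheme \<Rightarrow> 'o \<Rightarrow> 'o \<Rightarrow> 'm \<Rightarrow> 'm \<Rightarrow> bool" where
  "inverse_arrows C A B f g \<longleftrightarrow> f \<in> Hom C A B \<and> g \<in> Hom C B A \<and>
     g \<cdot>\<^bsub>C\<^esub> f = Id C A \<and> f \<cdot>\<^bsub>C\<^esub> g = Id C B"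

definition iso_arrow :: "('o, 'm, 'x) category_data_scheme \<Rightarrow> 'o \<Rightarrow> 'o \<Rightarrow> 'm \<Rightarrow> bool" where
  "iso_arrow C A B f \<longleftrightarrow> (\<exists>g. inverse_arrows C A B f g)"

definition isomorphic :: "('o, 'm, 'x) category_data_scheme \<Rightarrow> 'o \<Rightarrow> 'o \<Rightarrow> bool" where
  "isomorphic C A B \<longleftrightarrow> (\<exists>f. iso_arrow C A B f)"

record ('o, 'm) preadditive_data = "('o, 'm) category_data" +
  Add :: "'m \<Rightarrow> 'm \<Rightarrow> 'm"  (infixl "\<oplus>\<index>" 65)
  Zero :: "'o \<Rightarrow> 'o \<Rightarrow> 'm"

text \<open>
  The additive group of arrows between two objects, in the multiplicatively written group records
  of the library: \<open>mult\<close> is addition, \<open>one\<close> is the zero arrow and \<open>inv\<close> is negation.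
\<close>

definition Hom_group :: "('o, 'm, 'x) preadditive_data_scheme \<Rightarrow> 'o \<Rightarrow> 'o \<Rightarrow> 'm monoid" where
  "Hom_group C A B = \<lparr>carrier = Hom C A B, mult = Add C, one = Zero C A B\<rparr>"

definition neg :: "('o, 'm, 'x) preadditive_data_scheme \<Rightarrow> 'o \<Rightarrow> 'o \<Rightarrow> 'm \<Rightarrow> 'm" where
  "neg C A B f = inv\<^bsub>Hom_group C A B\<^esub> f"

locale preadditive_category = category C
  for C :: "('o, 'm, 'x) preadditive_data_scheme" (structure) +
  assumes Hom_comm_group: "\<lbrakk>X \<in> Obj C; Y \<in> Obj C\<rbrakk> \<Longrightarrow> comm_group (Hom_group C X Y)"
    and Comp_Add_right: "\<lbrakk>f \<in> Hom C X Y; f' \<in> Hom C X Y; g \<in> Hom C Y Z\<rbrakk>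
      \<Longrightarrow> g \<cdot> (f \<oplus> f') = (g \<cdot> f) \<oplus> (g \<cdot> f')"
    and Comp_Add_left: "\<lbrakk>f \<in> Hom C X Y; g \<in> Hom C Y Z; g' \<in> Hom C Y Z\<rbrakk>
      \<Longrightarrow> (g \<oplus> g') \<cdot> f = (g \<cdot> f) \<oplus> (g' \<cdot> f)"

definition zero_object :: "('o, 'm, 'x) preadditive_data_scheme \<Rightarrow> 'o \<Rightarrow> bool" where
  "zero_object C Z \<longleftrightarrow> Z \<in> Obj C \<and>
     (\<forall>A\<in>Obj C. Hom C A Z = {Zero C A Z} \<and> Hom C Z A = {Zero C Z A})"

definition direct_sum :: "('o, 'm, 'x) preadditive_data_scheme \<Rightarrow> 'o \<Rightarrow> 'o \<Rightarrow> 'o \<Rightarrow> bool" where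
  "direct_sum C A B P \<longleftrightarrow>
     (\<exists>i\<in>Hom C A P. \<exists>j\<in>Hom C B P. \<exists>p\<in>Hom C P A. \<exists>q\<in>Hom C P B.
        p \<cdot>\<^bsub>C\<^esub> i = Id C A \<and> q \<cdot>\<^bsub>C\<^esub> j = Id C B \<and>
        q \<cdot>\<^bsub>C\<^esub> i = Zero C A B \<and> p \<cdot>\<^bsub>C\<^esub> j = Zero C B A \<and>
        (i \<cdot>\<^bsub>C\<^esub> p) \<oplus>\<^bsub>C\<^esub> (j \<cdot>\<^bsub>C\<^esub> q) = Id C P)"

locale additive_category = preadditive_category C
  for C :: "('o, 'm, 'x) preadditive_data_scheme" (structure) +
  assumes ex_zero_object: "\<exists>Z. zero_object C Z"
    and ex_direct_sum: "\<lbrakk>X \<in> Obj C; Y \<in> Obj C\<rbrakk> \<Longrightarrow> \<exists>P. direct_sum C X Y P"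

section \<open>Triangulated categories\<close>

record ('o, 'm) triangulated_data = "('o, 'm) preadditive_data" +
  Sh :: "'o \<Rightarrow> 'o"
  ShA :: "'m \<Rightarrow> 'm"
  Dist :: "('m \<times> 'm \<times> 'm) set"

definition triangle ::
  "('o, 'm, 'x) triangulated_data_scheme \<Rightarrow> 'o \<Rightarrow> 'o \<Rightarrow> 'o \<Rightarrow> 'm \<Rightarrow> 'm \<Rightarrow> 'm \<Rightarrow> bool" where
  "triangle D A B C f g h \<longleftrightarrow> f \<in> Hom D A B \<and> g \<in> Hom D B C \<and> h \<in> Hom D C (Sh D A)"

definition dist_triangle ::
  "('o, 'm, 'x) triangulated_data_scheme \<Rightarrow> 'o \<Rightarrow> 'o \<Rightarrow> 'o \<Rightarrow> 'm \<Rightarrow> 'm \<Rightarrow> 'm \<Rightarrow> bool" where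
  "dist_triangle D A B C f g h \<longleftrightarrow> triangle D A B C f g h \<and> (f, g, h) \<in> Dist D"

text \<open>
  The shift \<open>[1]\<close>, given by \<open>Sh\<close> on objects and \<open>ShA\<close> on arrows, is only required to be an
  additive autoequivalence (a fully faithful, essentially surjective additive functor). This
  includes the case of an automorphism of categories. TR1 to TR4 are Verdier's axioms.
\<close>

locale triangulated_category = additive_category D
  for D :: "('o, 'm, 'x) triangulated_data_scheme" (structure) +
  assumes Sh_in_Obj: "X \<in> Obj D \<Longrightarrow> Sh D X \<in> Obj D"
    and ShA_hom: "\<lbrakk>X \<in> Obj D; Y \<in> Obj D\<rbrakk>
      \<Longrightarrow> ShA D \<in> hom (Hom_group D X Y) (Hom_group D (Sh D X) (Sh D Y))"
    and ShA_Id: "X \<in> Obj D \<Longrightarrow> ShA D (Id D X) = Id D (Sh D X)"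
    and ShA_Comp: "\<lbrakk>f \<in> Hom D X Y; g \<in> Hom D Y Z\<rbrakk> \<Longrightarrow> ShA D (g \<cdot> f) = ShA D g \<cdot> ShA D f"
    and ShA_fully_faithful: "\<lbrakk>X \<in> Obj D; Y \<in> Obj D\<rbrakk>
      \<Longrightarrow> bij_betw (ShA D) (Hom D X Y) (Hom D (Sh D X) (Sh D Y))"
    and Sh_ess_surj: "Y \<in> Obj D \<Longrightarrow> \<exists>X\<in>Obj D. isomorphic D (Sh D X) Y"
    and TR1_iso: "\<lbrakk>dist_triangle D X Y Z f g h; triangle D X' Y' Z' f' g' h';
        iso_arrow D X X' a; iso_arrow D Y Y' b; iso_arrow D Z Z' c;
        b \<cdot> f = f' \<cdot> a; c \<cdot> g = g' \<cdot> b; ShA D a \<cdot> h = h' \<cdot> c\<rbrakk>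
      \<Longrightarrow> dist_triangle D X' Y' Z' f' g' h'"
    and TR1_Id: "\<lbrakk>X \<in> Obj D; zero_object D Z\<rbrakk>
      \<Longrightarrow> dist_triangle D X X Z (Id D X) (Zero D X Z) (Zero D Z (Sh D X))"
    and TR1_ex: "f \<in> Hom D X Y \<Longrightarrow> \<exists>Z g h. dist_triangle D X Y Z f g h"
    and TR2: "triangle D X Y Z f g h
      \<Longrightarrow> dist_triangle D X Y Z f g h \<longleftrightarrow>
          dist_triangle D Y Z (Sh D X) g h (neg D (Sh D X) (Sh D Y) (ShA D f))"
    and TR3: "\<lbrakk>dist_triangle D X Y Z f g h; dist_triangle D X' Y' Z' f' g' h';
        a \<in> Hom D X X'; b \<in> Hom D Y Y'; b \<cdot> f = f' \<cdot> a\<rbrakk>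
      \<Longrightarrow> \<exists>c\<in>Hom D Z Z'. c \<cdot> g = g' \<cdot> b \<and> ShA D a \<cdot> h = h' \<cdot> c"
    and TR4: "\<lbrakk>dist_triangle D X Y Z' f f' f''; dist_triangle D Y Z X' g g' g'';
        dist_triangle D X Z Y' (g \<cdot> f) h' h''\<rbrakk>
      \<Longrightarrow> \<exists>u v. dist_triangle D Z' Y' X' u v (ShA D f' \<cdot> g'') \<and>
            u \<cdot> f' = h' \<cdot> g \<and> h'' \<cdot> u = f'' \<and> v \<cdot> h' = g' \<and> g'' \<cdot> v = ShA D f \<cdot> h''"

section \<open>Subcategories\<close>

text \<open>Full subcategories are identified with their sets of objects.\<close>

definition subcategory :: "('o, 'm, 'x) category_data_scheme \<Rightarrow> 'o set \<Rightarrow> bool" where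
  "subcategory C X \<longleftrightarrow> X \<subseteq> Obj C \<and> (\<forall>A\<in>X. \<forall>B. isomorphic C A B \<longrightarrow> B \<in> X)"

definition Hom_vanish ::
  "('o, 'm, 'x) preadditive_data_scheme \<Rightarrow> 'o set \<Rightarrow> 'o set \<Rightarrow> bool" where
  "Hom_vanish C X Y \<longleftrightarrow> (\<forall>A\<in>X. \<forall>B\<in>Y. Hom C A B = {Zero C A B})"

text \<open>
  Shifts of subcategories closed under isomorphisms. Since the shift need only be an
  autoequivalence, \<open>X[1]\<close> is the closure under isomorphisms of the image of \<open>X\<close>. An object \<open>A\<close>
  is isomorphic to \<open>B[-1]\<close> with \<open>B\<close> in \<open>X\<close> exactly if \<open>A[1]\<close> is in \<open>X\<close>, whatever
  quasi-inverse \<open>[-1]\<close> is chosen; so no choice enters the definition of \<open>X[-1]\<close>.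
\<close>

definition shift_pos :: "('o, 'm, 'x) triangulated_data_scheme \<Rightarrow> 'o set \<Rightarrow> 'o set" where
  "shift_pos D X = {A. \<exists>B\<in>X. isomorphic D (Sh D B) A}"

definition shift_neg :: "('o, 'm, 'x) triangulated_data_scheme \<Rightarrow> 'o set \<Rightarrow> 'o set" where
  "shift_neg D X = {A \<in> Obj D. Sh D A \<in> X}"

definition star :: "('o, 'm, 'x) triangulated_data_scheme \<Rightarrow> 'o set \<Rightarrow> 'o set \<Rightarrow> 'o set" where
  "star D X Y = {A. \<exists>B\<in>X. \<exists>C\<in>Y. \<exists>f g h. dist_triangle D B A C f g h}"

text \<open>
  Direct sums are finite ones; containing the zero objects is the case of the empty sum.
  Direct summands are taken inside \<open>K\<close>.
\<close>

definition additive_subcategory ::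
  "('o, 'm, 'x) preadditive_data_scheme \<Rightarrow> 'o set \<Rightarrow> 'o set \<Rightarrow> bool" where
  "additive_subcategory C K X \<longleftrightarrow> subcategory C X \<and> X \<subseteq> K \<and>
     (\<forall>Z. zero_object C Z \<longrightarrow> Z \<in> X) \<and>
     (\<forall>A\<in>X. \<forall>B\<in>X. \<forall>P. direct_sum C A B P \<longrightarrow> P \<in> X) \<and>
     (\<forall>A\<in>K. \<forall>B\<in>K. \<forall>P\<in>X. direct_sum C A B P \<longrightarrow> A \<in> X \<and> B \<in> X)"

section \<open>Torsion pairs and t-structures\<close>

text \<open>
  Below, \<open>K\<close> is intended to be \<open>Obj D\<close> or an extension-closed subcategory of \<open>D\<close>.
\<close>

definition torsion_pair ::
  "('o, 'm, 'x) triangulated_data_scheme \<Rightarrow> 'o set \<Rightarrow> 'o set \<times> 'o set \<Rightarrow> bool" where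
  "torsion_pair D K = (\<lambda>(T, F).
     additive_subcategory D K T \<and> additive_subcategory D K F \<and>
     Hom_vanish D T F \<and> K \<subseteq> star D T F)"

definition s_torsion_pair ::
  "('o, 'm, 'x) triangulated_data_scheme \<Rightarrow> 'o set \<Rightarrow> 'o set \<times> 'o set \<Rightarrow> bool" where
  "s_torsion_pair D K = (\<lambda>(T, F).
     torsion_pair D K (T, F) \<and> Hom_vanish D T (shift_neg D F))"

definition torsion_le ::
  "('o, 'm, 'x) triangulated_data_scheme \<Rightarrow> 'o set \<times> 'o set \<Rightarrow> 'o set \<times> 'o set \<Rightarrow> bool" where
  "torsion_le D = (\<lambda>(T1, F1) (T2, F2).
     Hom_vanish D T1 F2 \<and> Hom_vanish D T1 (shift_neg D F2))"

text \<open>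
  The components are the aisle in degrees at most 0 and the coaisle in degrees at least 0, so
  \<open>shift_neg D X\<close> consists of degrees at most 1 and \<open>shift_neg D Y\<close> of degrees at least 1.
\<close>

definition t_structure ::
  "('o, 'm, 'x) triangulated_data_scheme \<Rightarrow> 'o set \<times> 'o set \<Rightarrow> bool" where
  "t_structure D = (\<lambda>(X, Y).
     subcategory D X \<and> subcategory D Y \<and>
     Hom_vanish D X (shift_neg D Y) \<and> Obj D = star D X (shift_neg D Y) \<and>
     X \<subseteq> shift_neg D X \<and> shift_neg D Y \<subseteq> Y)"

definition aisle_le :: "'o set \<times> 'o set \<Rightarrow> 'o set \<times> 'o set \<Rightarrow> bool" where
  "aisle_le = (\<lambda>(X1, Y1) (X2, Y2). X1 \<subseteq> X2)"

definition inverse_order_bijections ::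
  "'a set \<Rightarrow> ('a \<Rightarrow> 'a \<Rightarrow> bool) \<Rightarrow> 'b set \<Rightarrow> ('b \<Rightarrow> 'b \<Rightarrow> bool) \<Rightarrow> ('a \<Rightarrow> 'b) \<Rightarrow> ('b \<Rightarrow> 'a) \<Rightarrow> bool" where
  "inverse_order_bijections A leA B leB \<phi> \<psi> \<longleftrightarrow>
     bij_betw \<phi> A B \<and> bij_betw \<psi> B A \<and>
     (\<forall>a\<in>A. \<psi> (\<phi> a) = a) \<and> (\<forall>b\<in>B. \<phi> (\<psi> b) = b) \<and>
     monotone_on A leA leB \<phi> \<and> monotone_on B leB leA \<psi>"

end

theory Submission
  imports Defs
begin

text \<open>
  Write \<open>K\<close> for the intersection of \<open>U2\<close> and \<open>V1\<close>. An object \<open>X\<close> of the triangulated category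
  has a filtration with a piece in \<open>U1\<close>, a piece in \<open>K\<close> and a piece in \<open>V2\<close>: its quotient \<open>Y\<close> in
  \<open>V1\<close> has a part in \<open>U2\<close>, and this part lies again in \<open>V1\<close> because the shifts of \<open>U1\<close> have no
  arrows to \<open>V2\<close>. A torsion pair \<open>(T, F)\<close> in \<open>K\<close> splits the middle piece, so \<open>X\<close> is built from pieces
  in \<open>U1\<close>, \<open>T\<close>, \<open>F\<close>, \<open>V2\<close>, and grouping the first two and the last two gives a torsion pair
  \<open>(U1 * T, F * V2)\<close>. Conversely a torsion pair \<open>(U, V)\<close> between the two given ones cuts \<open>K\<close> into
  its intersections with \<open>U\<close> and \<open>V\<close>: the triangle of an object of \<open>K\<close> has its outer
  terms in \<open>K\<close> because the shifts of \<open>U1\<close> lie in \<open>U\<close> and those of \<open>U\<close> lie in \<open>U2\<close>. These are the two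
  maps \<open>from_heart\<close> and \<open>to_heart\<close>.

  That \<open>U1 * T\<close> and \<open>F * V2\<close> are closed under direct summands is not visible from this description.
  So \<open>from_heart\<close> is defined by orthogonal complements, which have all closure properties for
  free, and the substance is that the left complement of \<open>F\<close> and \<open>V2\<close> lies in \<open>U1 * T\<close>
  (\<open>left_perp_subset_star\<close>). This is where the condition on the negative shift of \<open>F\<close> enters;
  the one on the shift of \<open>T\<close> gives the comparison with \<open>(U2, V2)\<close>. The octahedral axiom enters
  through the associativity of \<open>*\<close>, which regroups the four pieces.

  Two observations keep the rest formal. Torsion classes are orthogonal complements of the torsion-free
  ones (\<open>torsion_pair_perp\<close>), so everything reduces to vanishing of Hom sets along triangles; and
  vanishing into a negative shift is vanishing from the shifts (\<open>Hom_vanish_shift_neg\<close>), so no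
  quasi-inverse of the shift functor has to be chosen.

  The statement on t-structures is the restriction of this bijection to reflexive elements: in \<open>K\<close>
  the torsion pairs \<open>p\<close> with \<open>p \<preceq> p\<close> are the s-torsion pairs, and in the whole category they are the
  torsion pairs whose torsion class is closed under the shift, that is, the t-structures up to a
  shift of the coaisle. An order preserving bijection with order preserving inverse matches
  reflexive elements. Finally, when both given torsion pairs come from t-structures, the closure of
  aisles under the shift makes the shift conditions automatic.
\<close>

section \<open>Arithmetic of arrows\<close>

context preadditive_category
begin

lemma Hom_Obj: "f \<in> Hom C X Y \<Longrightarrow> X \<in> Obj C \<and> Y \<in> Obj C"
  using Dom_in_Obj Cod_in_Obj by (auto simp: Hom_def)

lemma Zero_in_Hom: "\<lbrakk>X \<in> Obj C; Y \<in> Obj C\<rbrakk> \<Longrightarrow> Zero C X Y \<in> Hom C X Y"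
  using monoid.one_closed[OF group.is_monoid[OF comm_group.axioms(2)[OF Hom_comm_group]], of X Y]
  by (simp add: Hom_group_def)

lemma Add_in_Hom: "\<lbrakk>f \<in> Hom C X Y; g \<in> Hom C X Y\<rbrakk> \<Longrightarrow> f \<oplus> g \<in> Hom C X Y"
  using monoid.m_closed[OF group.is_monoid[OF comm_group.axioms(2)[OF Hom_comm_group]], of X Y f g]
    Hom_Obj[of f X Y] by (simp add: Hom_group_def)

lemma neg_in_Hom: "f \<in> Hom C X Y \<Longrightarrow> neg C X Y f \<in> Hom C X Y"
  using group.inv_closed[OF comm_group.axioms(2)[OF Hom_comm_group], of X Y f]
    Hom_Obj[of f X Y] by (simp add: Hom_group_def neg_def)

lemma Add_Zero_right: "f \<in> Hom C X Y \<Longrightarrow> f \<oplus> Zero C X Y = f"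
  using monoid.r_one[OF group.is_monoid[OF comm_group.axioms(2)[OF Hom_comm_group]], of X Y f]
    Hom_Obj[of f X Y] by (simp add: Hom_group_def)

lemma Add_commute: "\<lbrakk>f \<in> Hom C X Y; g \<in> Hom C X Y\<rbrakk> \<Longrightarrow> f \<oplus> g = g \<oplus> f"
  using comm_monoid.m_comm[OF comm_group.axioms(1)[OF Hom_comm_group], of X Y f g]
    Hom_Obj[of f X Y] by (simp add: Hom_group_def)

lemma Add_assoc: "\<lbrakk>f \<in> Hom C X Y; g \<in> Hom C X Y; h \<in> Hom C X Y\<rbrakk>
    \<Longrightarrow> (f \<oplus> g) \<oplus> h = f \<oplus> (g \<oplus> h)"
  using monoid.m_assoc[OF group.is_monoid[OF comm_group.axioms(2)[OF Hom_comm_group]], of X Y f g h]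
    Hom_Obj[of f X Y] by (simp add: Hom_group_def)

lemma Add_neg: "f \<in> Hom C X Y \<Longrightarrow> f \<oplus> neg C X Y f = Zero C X Y"
  using group.r_inv[OF comm_group.axioms(2)[OF Hom_comm_group], of X Y f]
    Hom_Obj[of f X Y] by (simp add: Hom_group_def neg_def)

lemma neg_neg: "f \<in> Hom C X Y \<Longrightarrow> neg C X Y (neg C X Y f) = f"
  using group.inv_inv[OF comm_group.axioms(2)[OF Hom_comm_group], of X Y f]
    Hom_Obj[of f X Y] by (simp add: Hom_group_def neg_def)

lemma neg_Zero: "\<lbrakk>X \<in> Obj C; Y \<in> Obj C\<rbrakk> \<Longrightarrow> neg C X Y (Zero C X Y) = Zero C X Y"
  using monoid.inv_one[OF group.is_monoid[OF comm_group.axioms(2)[OF Hom_comm_group]], of X Y]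
  by (simp add: Hom_group_def neg_def)

lemma Add_eq_ZeroD:
  assumes "f \<in> Hom C X Y" "g \<in> Hom C X Y" "f \<oplus> g = Zero C X Y"
  shows "f = neg C X Y g"
  using group.inv_equality[OF comm_group.axioms(2)[OF Hom_comm_group], of X Y f g]
    Hom_Obj[of f X Y] assms by (simp add: Hom_group_def neg_def)

lemma Add_idem: "\<lbrakk>f \<in> Hom C X Y; f \<oplus> f = f\<rbrakk> \<Longrightarrow> f = Zero C X Y"
  using Add_assoc[of f X Y f "neg C X Y f"] by (simp add: Add_Zero_right Add_neg neg_in_Hom)

lemma Comp_Zero:
  assumes "g \<in> Hom C Y Z" "X \<in> Obj C" shows "g \<cdot> Zero C X Y = Zero C X Z"
proof -
  have 0: "Zero C X Y \<in> Hom C X Y" using assms Hom_Obj Zero_in_Hom by blast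
  show ?thesis
    using Add_idem[OF Comp_in_Hom[OF 0 assms(1)]] Comp_Add_right[OF 0 0 assms(1)] Add_Zero_right[OF 0]
    by simp
qed

lemma Zero_Comp:
  assumes "f \<in> Hom C X Y" "Z \<in> Obj C" shows "Zero C Y Z \<cdot> f = Zero C X Z"
proof -
  have 0: "Zero C Y Z \<in> Hom C Y Z" using assms Hom_Obj Zero_in_Hom by blast
  show ?thesis
    using Add_idem[OF Comp_in_Hom[OF assms(1) 0]] Comp_Add_left[OF assms(1) 0 0] Add_Zero_right[OF 0]
    by simp
qed

lemma Comp_neg:
  assumes "f \<in> Hom C X Y" "g \<in> Hom C Y Z" shows "g \<cdot> neg C X Y f = neg C X Z (g \<cdot> f)"
proof (rule Add_eq_ZeroD)
  show "g \<cdot> neg C X Y f \<in> Hom C X Z" "g \<cdot> f \<in> Hom C X Z"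
    using assms neg_in_Hom Comp_in_Hom by blast+
  show "g \<cdot> neg C X Y f \<oplus> g \<cdot> f = Zero C X Z"
    using assms Comp_Add_right[OF neg_in_Hom assms(1) assms(2)] Add_neg Add_commute neg_in_Hom
      Comp_Zero Hom_Obj by metis
qed

lemma neg_Comp:
  assumes "f \<in> Hom C X Y" "g \<in> Hom C Y Z" shows "neg C Y Z g \<cdot> f = neg C X Z (g \<cdot> f)"
proof (rule Add_eq_ZeroD)
  show "neg C Y Z g \<cdot> f \<in> Hom C X Z" "g \<cdot> f \<in> Hom C X Z"
    using assms neg_in_Hom Comp_in_Hom by blast+
  show "neg C Y Z g \<cdot> f \<oplus> g \<cdot> f = Zero C X Z"
    using assms Comp_Add_left[OF assms(1) neg_in_Hom assms(2)] Add_neg Add_commute neg_in_Hom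
      Zero_Comp Hom_Obj by metis
qed

lemma eq_if_difference_Zero:
  assumes "f \<in> Hom C X Y" "g \<in> Hom C X Y" "f \<oplus> neg C X Y g = Zero C X Y" shows "f = g"
  using Add_eq_ZeroD[OF assms(1) neg_in_Hom assms(3)] neg_neg assms by simp

lemma zero_object_iff: "zero_object C Z \<longleftrightarrow> Z \<in> Obj C \<and> Id C Z = Zero C Z Z"
proof
  assume "zero_object C Z" then show "Z \<in> Obj C \<and> Id C Z = Zero C Z Z"
    using Id_in_Hom by (fastforce simp: zero_object_def)
next
  assume z: "Z \<in> Obj C \<and> Id C Z = Zero C Z Z"
  then have "f = Zero C X Z" if "f \<in> Hom C X Z" for X f
    using Comp_Id_left[OF that] Zero_Comp[OF that] by simp
  moreover have "f = Zero C Z X" if "f \<in> Hom C Z X" for X f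
    using Comp_Id_right[OF that] Comp_Zero[OF that] z by simp
  ultimately show "zero_object C Z" using z Zero_in_Hom by (auto simp: zero_object_def)
qed

section \<open>Orthogonality\<close>

text \<open>
  A condition on pairs of objects rather than on subcategories: it passes to retracts of either
  object, which covers at once closure under isomorphisms and under direct summands.
\<close>

abbreviation orth :: "'o \<Rightarrow> 'o \<Rightarrow> bool" where
  "orth A B \<equiv> Hom C A B = {Zero C A B}"

lemma orthI: "\<lbrakk>A \<in> Obj C; B \<in> Obj C; \<And>u. u \<in> Hom C A B \<Longrightarrow> u = Zero C A B\<rbrakk> \<Longrightarrow> orth A B"
  using Zero_in_Hom by blast

lemma orth_retract_left:
  assumes "i \<in> Hom C A P" "p \<in> Hom C P A" "p \<cdot> i = Id C A" "orth P B" "B \<in> Obj C"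
  shows "orth A B"
proof (rule orthI)
  fix u assume u: "u \<in> Hom C A B"
  then have "u \<cdot> p = Zero C P B" using Comp_in_Hom assms by blast
  then show "u = Zero C A B"
    using Comp_assoc[OF assms(1,2) u] Comp_Id_right[OF u] Zero_Comp[OF assms(1,5)] assms(3) by simp
qed (use assms Hom_Obj in blast)+

lemma orth_retract_right:
  assumes "i \<in> Hom C B P" "p \<in> Hom C P B" "p \<cdot> i = Id C B" "orth A P" "A \<in> Obj C"
  shows "orth A B"
proof (rule orthI)
  fix u assume u: "u \<in> Hom C A B"
  then have "i \<cdot> u = Zero C A P" using Comp_in_Hom assms by blast
  then show "u = Zero C A B"
    using Comp_assoc[OF u assms(1,2)] Comp_Id_left[OF u] Comp_Zero[OF assms(2,5)] assms(3) by simp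
qed (use assms Hom_Obj in blast)+

lemma orth_isomorphic_left: "\<lbrakk>isomorphic C A A'; orth A B; B \<in> Obj C\<rbrakk> \<Longrightarrow> orth A' B"
  unfolding isomorphic_def iso_arrow_def inverse_arrows_def
  by (elim exE conjE) (rule orth_retract_left)

lemma orth_isomorphic_right: "\<lbrakk>isomorphic C B B'; orth A B; A \<in> Obj C\<rbrakk> \<Longrightarrow> orth A B'"
  unfolding isomorphic_def iso_arrow_def inverse_arrows_def
  by (elim exE conjE) (rule orth_retract_right)

lemma isomorphic_sym: "isomorphic C A B \<Longrightarrow> isomorphic C B A"
  unfolding isomorphic_def iso_arrow_def inverse_arrows_def by blast

lemma isomorphic_Obj: "isomorphic C A B \<Longrightarrow> A \<in> Obj C \<and> B \<in> Obj C"
  unfolding isomorphic_def iso_arrow_def inverse_arrows_def using Hom_Obj by blast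

lemma isomorphic_trans:
  assumes "isomorphic C A B" "isomorphic C B E" shows "isomorphic C A E"
proof -
  obtain u u' v v' where
    u: "u \<in> Hom C A B" "u' \<in> Hom C B A" "u' \<cdot> u = Id C A" "u \<cdot> u' = Id C B" and
    v: "v \<in> Hom C B E" "v' \<in> Hom C E B" "v' \<cdot> v = Id C B" "v \<cdot> v' = Id C E"
    using assms unfolding isomorphic_def iso_arrow_def inverse_arrows_def by blast
  note vu = Comp_in_Hom[OF u(1) v(1)] and uv = Comp_in_Hom[OF v(2) u(2)]
  have "(u' \<cdot> v') \<cdot> (v \<cdot> u) = Id C A"
    using Comp_assoc[OF vu v(2) u(2)] Comp_assoc[OF u(1) v(1) v(2)] v(3) u(3) Comp_Id_left[OF u(1)] by simp
  moreover have "(v \<cdot> u) \<cdot> (u' \<cdot> v') = Id C E"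
    using Comp_assoc[OF uv u(1) v(1)] Comp_assoc[OF v(2) u(2) u(1)] v(4) u(4) Comp_Id_left[OF v(2)] by simp
  ultimately show ?thesis
    using vu uv unfolding isomorphic_def iso_arrow_def inverse_arrows_def by blast
qed

definition left_perp :: "'o set \<Rightarrow> 'o set" where
  "left_perp S = {A \<in> Obj C. \<forall>B\<in>S. orth A B}"

definition right_perp :: "'o set \<Rightarrow> 'o set" where
  "right_perp S = {B \<in> Obj C. \<forall>A\<in>S. orth A B}"

text \<open>
  An arrow out of a direct sum is determined by its restrictions to the two summands, and a summand
  is a retract; dually for the right complement.
\<close>

lemma additive_left_perp:
  assumes "S \<subseteq> Obj C" shows "additive_subcategory C (Obj C) (left_perp S)"
  unfolding additive_subcategory_def subcategory_def
proof (intro conjI ballI allI impI)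
  fix A B assume A: "A \<in> left_perp S" and iso: "isomorphic C A B"
  show "B \<in> left_perp S"
    using A orth_isomorphic_left[OF iso] isomorphic_Obj[OF iso] assms
    unfolding left_perp_def by blast
next
  fix Z assume "zero_object C Z" then show "Z \<in> left_perp S"
    using assms by (auto simp: zero_object_def left_perp_def)
next
  fix A B P assume A: "A \<in> left_perp S" and B: "B \<in> left_perp S" and "direct_sum C A B P"
  then obtain i j p q where
    i: "i \<in> Hom C A P" and j: "j \<in> Hom C B P" and p: "p \<in> Hom C P A" and q: "q \<in> Hom C P B"
    and sum: "i \<cdot> p \<oplus> j \<cdot> q = Id C P" by (auto simp: direct_sum_def)
  have P: "P \<in> Obj C" using i Hom_Obj by blast
  have "orth P W" if "W \<in> S" for W
  proof (rule orthI)
    show W: "W \<in> Obj C" using that assms by blast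
    fix u assume u: "u \<in> Hom C P W"
    have "u \<cdot> i = Zero C A W" "u \<cdot> j = Zero C B W"
      using A B that Comp_in_Hom[OF i u] Comp_in_Hom[OF j u] by (auto simp: left_perp_def)
    moreover have "u = (u \<cdot> i) \<cdot> p \<oplus> (u \<cdot> j) \<cdot> q"
      using Comp_Id_right[OF u] Comp_Add_right[OF Comp_in_Hom[OF p i] Comp_in_Hom[OF q j] u]
        Comp_assoc[OF p i u] Comp_assoc[OF q j u] sum by simp
    ultimately show "u = Zero C P W"
      using Zero_Comp[OF p W] Zero_Comp[OF q W] Add_Zero_right[OF Zero_in_Hom[OF P W]] by simp
  qed (fact P)
  then show "P \<in> left_perp S" using P by (auto simp: left_perp_def)
next
  fix A B P assume P: "P \<in> left_perp S" and "direct_sum C A B P"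
  then obtain i j p q where
    i: "i \<in> Hom C A P" and j: "j \<in> Hom C B P" and p: "p \<in> Hom C P A" and q: "q \<in> Hom C P B"
    and pi: "p \<cdot> i = Id C A" and qj: "q \<cdot> j = Id C B" by (auto simp: direct_sum_def)
  show "A \<in> left_perp S" "B \<in> left_perp S"
    using orth_retract_left[OF i p pi] orth_retract_left[OF j q qj] P assms Hom_Obj[OF i] Hom_Obj[OF j]
    unfolding left_perp_def by blast+
qed (auto simp: left_perp_def)

lemma additive_right_perp:
  assumes "S \<subseteq> Obj C" shows "additive_subcategory C (Obj C) (right_perp S)"
  unfolding additive_subcategory_def subcategory_def
proof (intro conjI ballI allI impI)
  fix A B assume A: "A \<in> right_perp S" and iso: "isomorphic C A B"
  show "B \<in> right_perp S"
    using A orth_isomorphic_right[OF iso] isomorphic_Obj[OF iso] assms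
    unfolding right_perp_def by blast
next
  fix Z assume "zero_object C Z" then show "Z \<in> right_perp S"
    using assms by (auto simp: zero_object_def right_perp_def)
next
  fix A B P assume A: "A \<in> right_perp S" and B: "B \<in> right_perp S" and "direct_sum C A B P"
  then obtain i j p q where
    i: "i \<in> Hom C A P" and j: "j \<in> Hom C B P" and p: "p \<in> Hom C P A" and q: "q \<in> Hom C P B"
    and sum: "i \<cdot> p \<oplus> j \<cdot> q = Id C P" by (auto simp: direct_sum_def)
  have P: "P \<in> Obj C" using i Hom_Obj by blast
  have "orth W P" if "W \<in> S" for W
  proof (rule orthI)
    show W: "W \<in> Obj C" using that assms by blast
    fix u assume u: "u \<in> Hom C W P"
    have "p \<cdot> u = Zero C W A" "q \<cdot> u = Zero C W B"
      using A B that Comp_in_Hom[OF u p] Comp_in_Hom[OF u q] by (auto simp: right_perp_def)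
    moreover have "u = i \<cdot> (p \<cdot> u) \<oplus> j \<cdot> (q \<cdot> u)"
      using Comp_Id_left[OF u] Comp_Add_left[OF u Comp_in_Hom[OF p i] Comp_in_Hom[OF q j]]
        Comp_assoc[OF u p i] Comp_assoc[OF u q j] sum by simp
    ultimately show "u = Zero C W P"
      using Comp_Zero[OF i W] Comp_Zero[OF j W] Add_Zero_right[OF Zero_in_Hom[OF W P]] by simp
  qed (fact P)
  then show "P \<in> right_perp S" using P by (auto simp: right_perp_def)
next
  fix A B P assume P: "P \<in> right_perp S" and "direct_sum C A B P"
  then obtain i j p q where
    i: "i \<in> Hom C A P" and j: "j \<in> Hom C B P" and p: "p \<in> Hom C P A" and q: "q \<in> Hom C P B"
    and pi: "p \<cdot> i = Id C A" and qj: "q \<cdot> j = Id C B" by (auto simp: direct_sum_def)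
  show "A \<in> right_perp S" "B \<in> right_perp S"
    using orth_retract_right[OF i p pi] orth_retract_right[OF j q qj] P assms Hom_Obj[OF i] Hom_Obj[OF j]
    unfolding right_perp_def by blast+
qed (auto simp: right_perp_def)

lemma additive_subcategoryD:
  assumes "additive_subcategory C K X"
  shows "X \<subseteq> K" "X \<subseteq> Obj C" "subcategory C X"
    and "\<lbrakk>A \<in> X; isomorphic C A B\<rbrakk> \<Longrightarrow> B \<in> X"
    and "zero_object C Z \<Longrightarrow> Z \<in> X"
    and "\<lbrakk>A \<in> X; B \<in> X; direct_sum C A B P\<rbrakk> \<Longrightarrow> P \<in> X"
    and "\<lbrakk>A \<in> K; B \<in> K; P \<in> X; direct_sum C A B P\<rbrakk> \<Longrightarrow> A \<in> X \<and> B \<in> X"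
  using assms unfolding additive_subcategory_def subcategory_def by meson+

lemma additive_Int:
  assumes X: "additive_subcategory C (Obj C) X" and Y: "additive_subcategory C (Obj C) Y"
    and K: "X \<inter> Y \<subseteq> K" "K \<subseteq> Obj C"
  shows "additive_subcategory C K (X \<inter> Y)"
  unfolding additive_subcategory_def subcategory_def
proof (intro conjI ballI allI impI)
  fix A B P assume "A \<in> K" "B \<in> K" "P \<in> X \<inter> Y" "direct_sum C A B P"
  then show "A \<in> X \<inter> Y" "B \<in> X \<inter> Y"
    using additive_subcategoryD(7)[OF X, of A B P] additive_subcategoryD(7)[OF Y, of A B P] K(2) by blast+
qed (use K additive_subcategoryD(4-6)[OF X] additive_subcategoryD(4-6)[OF Y] in blast)+

end


section \<open>Exactness of distinguished triangles\<close>

context triangulated_category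
begin

lemma dist_Hom:
  assumes "dist_triangle D A B C f g h"
  shows "f \<in> Hom D A B" "g \<in> Hom D B C" "h \<in> Hom D C (Sh D A)"
    and "A \<in> Obj D" "B \<in> Obj D" "C \<in> Obj D"
proof -
  show *: "f \<in> Hom D A B" "g \<in> Hom D B C" "h \<in> Hom D C (Sh D A)"
    using assms by (auto simp: dist_triangle_def triangle_def)
  show "A \<in> Obj D" "B \<in> Obj D" "C \<in> Obj D"
    using Hom_Obj[OF *(1)] Hom_Obj[OF *(2)] by auto
qed

lemma ShA_in_Hom:
  assumes "f \<in> Hom D X Y" shows "ShA D f \<in> Hom D (Sh D X) (Sh D Y)"
  using ShA_fully_faithful[of X Y] Hom_Obj[OF assms] assms by (auto simp: bij_betw_def)

lemma ShA_faithful: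
  assumes "f \<in> Hom D X Y" "g \<in> Hom D X Y" "ShA D f = ShA D g" shows "f = g"
  using ShA_fully_faithful[of X Y] Hom_Obj[OF assms(1)] assms by (auto simp: bij_betw_def dest: inj_onD)

lemma ShA_full:
  assumes "u \<in> Hom D (Sh D X) (Sh D Y)" "X \<in> Obj D" "Y \<in> Obj D"
  obtains k where "k \<in> Hom D X Y" "ShA D k = u"
  using ShA_fully_faithful[of X Y] assms unfolding bij_betw_def by (metis imageE)

lemma ShA_Add:
  assumes "f \<in> Hom D X Y" "g \<in> Hom D X Y" shows "ShA D (f \<oplus> g) = ShA D f \<oplus> ShA D g"
  using ShA_hom[of X Y] Hom_Obj[OF assms(1)] assms by (auto simp: hom_def Hom_group_def)

lemma ShA_Zero:
  assumes "X \<in> Obj D" "Y \<in> Obj D" shows "ShA D (Zero D X Y) = Zero D (Sh D X) (Sh D Y)"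
proof -
  have 0: "Zero D X Y \<in> Hom D X Y" using assms Zero_in_Hom by blast
  show ?thesis using Add_idem[OF ShA_in_Hom[OF 0]] ShA_Add[OF 0 0] Add_Zero_right[OF 0] by simp
qed

lemma ShA_eq_Zero:
  assumes "u \<in> Hom D X Y" "ShA D u = Zero D (Sh D X) (Sh D Y)" shows "u = Zero D X Y"
  using ShA_faithful[OF assms(1)] assms ShA_Zero Zero_in_Hom Hom_Obj by metis

lemma zero_object_Sh:
  assumes "Z \<in> Obj D" shows "zero_object D (Sh D Z) \<longleftrightarrow> zero_object D Z"
proof -
  have "Id D (Sh D Z) = Zero D (Sh D Z) (Sh D Z) \<longleftrightarrow> Id D Z = Zero D Z Z"
    using ShA_Id[OF assms] ShA_Zero[OF assms assms] ShA_eq_Zero[OF Id_in_Hom[OF assms]] by auto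
  then show ?thesis using assms Sh_in_Obj zero_object_iff by blast
qed

lemma orth_Sh:
  assumes "A \<in> Obj D" "B \<in> Obj D" shows "orth (Sh D A) (Sh D B) \<longleftrightarrow> orth A B"
proof
  assume o: "orth (Sh D A) (Sh D B)"
  show "orth A B"
  proof (rule orthI)
    fix u assume u: "u \<in> Hom D A B"
    show "u = Zero D A B" using ShA_eq_Zero[OF u] ShA_in_Hom[OF u] o by blast
  qed (use assms in blast)+
next
  assume o: "orth A B"
  show "orth (Sh D A) (Sh D B)"
  proof (rule orthI)
    fix u assume "u \<in> Hom D (Sh D A) (Sh D B)"
    then obtain k where "k \<in> Hom D A B" "ShA D k = u" using ShA_full assms by blast
    then show "u = Zero D (Sh D A) (Sh D B)" using o ShA_Zero[OF assms] by auto
  qed (use assms Sh_in_Obj in blast)+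
qed

lemma isomorphic_Sh:
  assumes "A \<in> Obj D" "B \<in> Obj D"
  shows "isomorphic D (Sh D A) (Sh D B) \<longleftrightarrow> isomorphic D A B"
proof
  assume "isomorphic D A B"
  then obtain u v where u: "u \<in> Hom D A B" and v: "v \<in> Hom D B A"
    and vu: "v \<cdot> u = Id D A" "u \<cdot> v = Id D B"
    unfolding isomorphic_def iso_arrow_def inverse_arrows_def by blast
  have "ShA D v \<cdot> ShA D u = Id D (Sh D A)" "ShA D u \<cdot> ShA D v = Id D (Sh D B)"
    using ShA_Comp[OF u v] ShA_Comp[OF v u] vu ShA_Id assms by simp_all
  then show "isomorphic D (Sh D A) (Sh D B)"
    using ShA_in_Hom[OF u] ShA_in_Hom[OF v]
    unfolding isomorphic_def iso_arrow_def inverse_arrows_def by blast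
next
  assume iso: "isomorphic D (Sh D A) (Sh D B)"
  obtain u v where u: "u \<in> Hom D (Sh D A) (Sh D B)" and v: "v \<in> Hom D (Sh D B) (Sh D A)"
    and vu: "v \<cdot> u = Id D (Sh D A)" "u \<cdot> v = Id D (Sh D B)"
    using iso unfolding isomorphic_def iso_arrow_def inverse_arrows_def by blast
  obtain k l where k: "k \<in> Hom D A B" "ShA D k = u" and l: "l \<in> Hom D B A" "ShA D l = v"
    using ShA_full u v assms by metis
  have "l \<cdot> k = Id D A"
    by (rule ShA_faithful[OF Comp_in_Hom[OF k(1) l(1)] Id_in_Hom])
      (use ShA_Comp[OF k(1) l(1)] ShA_Id assms vu k l in simp_all)
  moreover have "k \<cdot> l = Id D B"
    by (rule ShA_faithful[OF Comp_in_Hom[OF l(1) k(1)] Id_in_Hom])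
      (use ShA_Comp[OF l(1) k(1)] ShA_Id assms vu k l in simp_all)
  ultimately show "isomorphic D A B"
    using k l unfolding isomorphic_def iso_arrow_def inverse_arrows_def by blast
qed

lemma dist_rotate:
  "dist_triangle D X Y Z f g h
    \<Longrightarrow> dist_triangle D Y Z (Sh D X) g h (neg D (Sh D X) (Sh D Y) (ShA D f))"
  using TR2[of X Y Z f g h] by (auto simp: dist_triangle_def)

text \<open>
  The map of triangles from \<open>X \<rightarrow> X \<rightarrow> 0\<close> to the given one factors \<open>g \<cdot> f\<close> through a zero object.
\<close>

lemma dist_comp_Zero:
  assumes t: "dist_triangle D X Y Z f g h" shows "g \<cdot> f = Zero D X Z"
proof -
  note H = dist_Hom[OF t]
  obtain N where N: "zero_object D N" using ex_zero_object by blast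
  then have "N \<in> Obj D" by (simp add: zero_object_def)
  obtain c where c: "c \<in> Hom D N Z" "c \<cdot> Zero D X N = g \<cdot> f"
    using TR3[OF TR1_Id[OF H(4) N] t Id_in_Hom[OF H(4)] H(1)] by auto
  then show ?thesis using Comp_Zero[OF c(1) H(4)] by simp
qed

text \<open>
  The fill-in is applied to the rotated triangles \<open>W \<rightarrow> 0 \<rightarrow> W[1]\<close> and \<open>Y \<rightarrow> Z \<rightarrow> X[1]\<close>; the signs introduced
  by rotation cancel, and fullness and faithfulness of the shift bring the result back to degree 0.
\<close>

lemma weak_kernel:
  assumes t: "dist_triangle D X Y Z f g h" and u: "u \<in> Hom D W Y" and gu: "g \<cdot> u = Zero D W Z"
  obtains k where "k \<in> Hom D W X" "f \<cdot> k = u"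
proof -
  note H = dist_Hom[OF t]
  have W: "W \<in> Obj D" using Hom_Obj[OF u] by blast
  obtain N where N: "zero_object D N" using ex_zero_object by blast
  then have N': "N \<in> Obj D" by (simp add: zero_object_def)
  let ?n = "neg D (Sh D W) (Sh D W) (ShA D (Id D W))"
  let ?f = "neg D (Sh D X) (Sh D Y) (ShA D f)"
  have 1: "dist_triangle D W N (Sh D W) (Zero D W N) (Zero D N (Sh D W)) ?n"
    by (rule dist_rotate[OF TR1_Id[OF W N]])
  have "Zero D N Z \<cdot> Zero D W N = g \<cdot> u"
    using gu Zero_Comp[OF Zero_in_Hom[OF W N'] H(6)] by simp
  then obtain c where c: "c \<in> Hom D (Sh D W) (Sh D X)" "ShA D u \<cdot> ?n = ?f \<cdot> c"
    using TR3[OF 1 dist_rotate[OF t] u Zero_in_Hom[OF N' H(6)]] by auto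
  obtain k where k: "k \<in> Hom D W X" "ShA D k = c" using ShA_full[OF c(1) W H(4)] by blast
  note su = ShA_in_Hom[OF u] and sf = ShA_in_Hom[OF H(1)]
  have "neg D (Sh D W) (Sh D Y) (ShA D u) = neg D (Sh D W) (Sh D Y) (ShA D f \<cdot> c)"
    using c(2) Comp_neg[OF ShA_in_Hom[OF Id_in_Hom[OF W]] su] neg_Comp[OF c(1) sf]
      ShA_Id[OF W] Comp_Id_right[OF su] by simp
  then have "ShA D u = ShA D (f \<cdot> k)"
    using neg_neg[OF su] neg_neg[OF Comp_in_Hom[OF c(1) sf]] ShA_Comp[OF k(1) H(1)] k(2) by metis
  then have "f \<cdot> k = u" using ShA_faithful[OF u Comp_in_Hom[OF k(1) H(1)]] by simp
  then show ?thesis using that k(1) by blast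
qed

text \<open>
  Exactness at the first object. The arrow \<open>u\<close> would lift to the predecessor \<open>Z[-1]\<close> of \<open>X\<close>; the
  lifting is stated after one shift, which avoids the negative shift.
\<close>

lemma weak_kernel_first:
  assumes t: "dist_triangle D X Y Z f g h" and u: "u \<in> Hom D W X" and fu: "f \<cdot> u = Zero D W Y"
  obtains k where "k \<in> Hom D (Sh D W) Z" "h \<cdot> k = ShA D u"
proof -
  note H = dist_Hom[OF t]
  have "ShA D f \<cdot> ShA D u = Zero D (Sh D W) (Sh D Y)"
    using ShA_Comp[OF u H(1)] fu ShA_Zero Hom_Obj[OF u] H(5) by simp
  then have "neg D (Sh D X) (Sh D Y) (ShA D f) \<cdot> ShA D u = Zero D (Sh D W) (Sh D Y)"
    using neg_Comp[OF ShA_in_Hom[OF u] ShA_in_Hom[OF H(1)]] neg_Zero Hom_Obj[OF u] H(5) Sh_in_Obj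
    by simp
  then show ?thesis
    using weak_kernel[OF dist_rotate[OF dist_rotate[OF t]] ShA_in_Hom[OF u]] that by blast
qed

lemma dist_Zero_Id:
  assumes "W \<in> Obj D" "zero_object D N"
  shows "dist_triangle D N W W (Zero D N W) (Id D W) (Zero D W (Sh D N))"
proof -
  have N: "N \<in> Obj D" using assms by (simp add: zero_object_def)
  have Nz: "zero_object D (Sh D N)" using zero_object_Sh[OF N] assms by blast
  have "dist_triangle D W W (Sh D N) (Id D W) (Zero D W (Sh D N)) (Zero D (Sh D N) (Sh D W))"
    by (rule TR1_Id[OF assms(1) Nz])
  moreover have "neg D (Sh D N) (Sh D W) (ShA D (Zero D N W)) = Zero D (Sh D N) (Sh D W)"
    using ShA_Zero neg_Zero assms(1) N Sh_in_Obj by simp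
  moreover have "triangle D N W W (Zero D N W) (Id D W) (Zero D W (Sh D N))"
    unfolding triangle_def using Zero_in_Hom Id_in_Hom assms(1) N Sh_in_Obj by blast
  ultimately show ?thesis using TR2 by metis
qed

lemma weak_cokernel:
  assumes t: "dist_triangle D X Y Z f g h" and u: "u \<in> Hom D Y W" and uf: "u \<cdot> f = Zero D X W"
  obtains k where "k \<in> Hom D Z W" "k \<cdot> g = u"
proof -
  note H = dist_Hom[OF t]
  have W: "W \<in> Obj D" using Hom_Obj[OF u] by blast
  obtain N where N: "zero_object D N" using ex_zero_object by blast
  then have N': "N \<in> Obj D" by (simp add: zero_object_def)
  have "u \<cdot> f = Zero D N W \<cdot> Zero D X N"
    using uf Zero_Comp[OF Zero_in_Hom[OF H(4) N'] W] by simp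
  then obtain c where c: "c \<in> Hom D Z W" "c \<cdot> g = Id D W \<cdot> u"
    using TR3[OF t dist_Zero_Id[OF W N] Zero_in_Hom[OF H(4) N'] u] by auto
  then show ?thesis using that Comp_Id_left[OF u] by simp
qed

lemma weak_cokernel_second:
  assumes t: "dist_triangle D X Y Z f g h" and u: "u \<in> Hom D Z W" and ug: "u \<cdot> g = Zero D Y W"
  obtains k where "k \<in> Hom D (Sh D X) W" "k \<cdot> h = u"
  using weak_cokernel[OF dist_rotate[OF t] u ug] that by blast

text \<open>
  If the connecting arrow \<open>h\<close> vanishes, then \<open>g\<close> is an epimorphism and \<open>f\<close> is a monomorphism.
\<close>

lemma epi_second:
  assumes t: "dist_triangle D X Y Z f g h" and h: "h = Zero D Z (Sh D X)"
    and u: "u \<in> Hom D Z W" "v \<in> Hom D Z W" and eq: "u \<cdot> g = v \<cdot> g"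
  shows "u = v"
proof (rule eq_if_difference_Zero[OF u])
  note H = dist_Hom[OF t]
  let ?d = "u \<oplus> neg D Z W v"
  have d: "?d \<in> Hom D Z W" using u Add_in_Hom neg_in_Hom by blast
  have "?d \<cdot> g = Zero D Y W"
    using Comp_Add_left[OF H(2) u(1) neg_in_Hom[OF u(2)]] neg_Comp[OF H(2) u(2)] eq
      Add_neg[OF Comp_in_Hom[OF H(2) u(2)]] by simp
  then obtain k where k: "k \<in> Hom D (Sh D X) W" "k \<cdot> h = ?d" using weak_cokernel_second[OF t d] by blast
  then show "?d = Zero D Z W" using Comp_Zero[OF k(1) H(6)] h by simp
qed

lemma mono_first:
  assumes t: "dist_triangle D X Y Z f g h" and h: "h = Zero D Z (Sh D X)"
    and u: "u \<in> Hom D W X" "v \<in> Hom D W X" and eq: "f \<cdot> u = f \<cdot> v"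
  shows "u = v"
proof (rule eq_if_difference_Zero[OF u])
  note H = dist_Hom[OF t]
  let ?d = "u \<oplus> neg D W X v"
  have d: "?d \<in> Hom D W X" using u Add_in_Hom neg_in_Hom by blast
  have "f \<cdot> ?d = Zero D W Y"
    using Comp_Add_right[OF u(1) neg_in_Hom[OF u(2)] H(1)] Comp_neg[OF u(2) H(1)] eq
      Add_neg[OF Comp_in_Hom[OF u(2) H(1)]] by simp
  then obtain k where k: "k \<in> Hom D (Sh D W) Z" "h \<cdot> k = ShA D ?d" using weak_kernel_first[OF t d] by blast
  then have "ShA D ?d = Zero D (Sh D W) (Sh D X)" using Zero_Comp[OF k(1)] Sh_in_Obj[OF H(4)] h by simp
  then show "?d = Zero D W X" using ShA_eq_Zero[OF d] by simp
qed

text \<open>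
  The cone of a section \<open>s\<close> of \<open>f\<close> is a complement of \<open>A\<close> in \<open>P\<close>: the connecting arrow \<open>h\<close> of its
  triangle vanishes since \<open>s[1]\<close> is a split monomorphism that kills it, and the idempotent
  \<open>1 - s \<cdot> f\<close>, which kills \<open>s\<close>, factors through the cone. The factorisation is the second injection.
\<close>

lemma split_epi_direct_sum:
  assumes f: "f \<in> Hom D P A" and s: "s \<in> Hom D A P" and fs: "f \<cdot> s = Id D A"
  obtains B where "B \<in> Obj D" "direct_sum D A B P"
proof -
  obtain B g h where t: "dist_triangle D A P B s g h" using TR1_ex[OF s] by blast
  note H = dist_Hom[OF t]
  have P: "P \<in> Obj D" and A: "A \<in> Obj D" using H by auto
  note ss = ShA_in_Hom[OF s]
  have "neg D (Sh D A) (Sh D P) (ShA D s) \<cdot> h = Zero D B (Sh D P)"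
    using dist_comp_Zero[OF dist_rotate[OF dist_rotate[OF t]]] .
  then have "neg D B (Sh D P) (ShA D s \<cdot> h) = Zero D B (Sh D P)" using neg_Comp[OF H(3) ss] by simp
  then have "ShA D s \<cdot> h = Zero D B (Sh D P)"
    using neg_neg[OF Comp_in_Hom[OF H(3) ss]] neg_Zero[OF H(6) Sh_in_Obj[OF P]] by simp
  moreover have "h = ShA D f \<cdot> (ShA D s \<cdot> h)"
    using Comp_assoc[OF H(3) ss ShA_in_Hom[OF f]] ShA_Comp[OF s f] fs ShA_Id[OF A] Comp_Id_left[OF H(3)]
    by simp
  ultimately have h: "h = Zero D B (Sh D A)" using Comp_Zero[OF ShA_in_Hom[OF f] H(6)] by simp
  let ?sf = "s \<cdot> f" and ?e = "Id D P \<oplus> neg D P P (s \<cdot> f)"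
  have sf: "?sf \<in> Hom D P P" using Comp_in_Hom[OF f s] .
  have I: "Id D P \<in> Hom D P P" using Id_in_Hom[OF P] .
  have e: "?e \<in> Hom D P P" using Add_in_Hom[OF I neg_in_Hom[OF sf]] .
  have "?e \<cdot> s = Zero D A P"
    using Comp_Add_left[OF s I neg_in_Hom[OF sf]] neg_Comp[OF s sf] Comp_assoc[OF s f s] fs
      Comp_Id_right[OF s] Comp_Id_left[OF s] Add_neg[OF s] by simp
  then obtain j where j: "j \<in> Hom D B P" and jg: "j \<cdot> g = ?e" using weak_cokernel[OF t e] by blast
  have gs: "g \<cdot> s = Zero D A B" using dist_comp_Zero[OF t] .
  have sum: "?sf \<oplus> j \<cdot> g = Id D P"
    using jg Add_commute[OF sf e] Add_assoc[OF I neg_in_Hom[OF sf] sf]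
      Add_commute[OF neg_in_Hom[OF sf] sf] Add_neg[OF sf] Add_Zero_right[OF I] by simp
  \<comment> \<open>The remaining identities are checked after composition with the epimorphism \<open>g\<close>.\<close>
  have fj: "f \<cdot> j = Zero D B A"
  proof (rule epi_second[OF t h])
    have "(f \<cdot> j) \<cdot> g = f \<cdot> ?e" using Comp_assoc[OF H(2) j f] jg by simp
    also have "\<dots> = f \<oplus> neg D P A f"
      using Comp_Add_right[OF I neg_in_Hom[OF sf] f] Comp_neg[OF sf f] Comp_assoc[OF f s f] fs
        Comp_Id_right[OF f] Comp_Id_left[OF f] by simp
    also have "\<dots> = Zero D B A \<cdot> g" using Add_neg[OF f] Zero_Comp[OF H(2) A] by simp
    finally show "(f \<cdot> j) \<cdot> g = Zero D B A \<cdot> g" .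
  qed (use Comp_in_Hom[OF j f] Zero_in_Hom[OF H(6) A] in simp_all)
  have gj: "g \<cdot> j = Id D B"
  proof (rule epi_second[OF t h])
    have "(g \<cdot> j) \<cdot> g = g \<cdot> ?e" using Comp_assoc[OF H(2) j H(2)] jg by simp
    also have "\<dots> = g"
      using Comp_Add_right[OF I neg_in_Hom[OF sf] H(2)] Comp_neg[OF sf H(2)] Comp_assoc[OF f s H(2)] gs
        Comp_Id_right[OF H(2)] Zero_Comp[OF f H(6)] neg_Zero[OF P H(6)] Add_Zero_right[OF H(2)] by simp
    finally show "(g \<cdot> j) \<cdot> g = Id D B \<cdot> g" using Comp_Id_left[OF H(2)] by simp
  qed (use Comp_in_Hom[OF j H(2)] Id_in_Hom[OF H(6)] in simp_all)
  show ?thesis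
    using that[OF H(6)] s j f H(2) fs gj gs fj sum unfolding direct_sum_def by blast
qed

lemma dist_second_Zero_retract:
  assumes t: "dist_triangle D A X B f g h" and g: "g = Zero D X B"
  obtains s where "s \<in> Hom D X A" "f \<cdot> s = Id D X"
  using weak_kernel[OF t Id_in_Hom] dist_Hom[OF t] Comp_Id_right g by metis

lemma dist_first_Zero_retract:
  assumes t: "dist_triangle D A X B f g h" and f: "f = Zero D A X"
  obtains s where "s \<in> Hom D B X" "s \<cdot> g = Id D X"
  using weak_cokernel[OF t Id_in_Hom] dist_Hom[OF t] Comp_Id_left f by metis

lemma dist_third_zero_object_isomorphic:
  assumes t: "dist_triangle D A X B f g h" and B: "zero_object D B"
  shows "isomorphic D A X"
proof -
  note H = dist_Hom[OF t]
  have g: "g = Zero D X B" using B H unfolding zero_object_def by blast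
  have h: "h = Zero D B (Sh D A)" using B H Sh_in_Obj unfolding zero_object_def by blast
  obtain s where s: "s \<in> Hom D X A" "f \<cdot> s = Id D X" using dist_second_Zero_retract[OF t g] .
  have "s \<cdot> f = Id D A"
    by (rule mono_first[OF t h Comp_in_Hom[OF H(1) s(1)] Id_in_Hom[OF H(4)]])
      (use Comp_assoc[OF H(1) s(1) H(1)] s(2) Comp_Id_left[OF H(1)] Comp_Id_right[OF H(1)] in simp)
  then show ?thesis using H(1) s unfolding isomorphic_def iso_arrow_def inverse_arrows_def by blast
qed

lemma dist_first_zero_object_isomorphic:
  assumes t: "dist_triangle D A X B f g h" and A: "zero_object D A"
  shows "isomorphic D B X"
proof -
  note H = dist_Hom[OF t]
  have f: "f = Zero D A X" using A H unfolding zero_object_def by blast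
  have "zero_object D (Sh D A)" using A zero_object_Sh[OF H(4)] by blast
  then have h: "h = Zero D B (Sh D A)" using H unfolding zero_object_def by blast
  obtain s where s: "s \<in> Hom D B X" "s \<cdot> g = Id D X" using dist_first_Zero_retract[OF t f] .
  have "g \<cdot> s = Id D B"
    by (rule epi_second[OF t h Comp_in_Hom[OF s(1) H(2)] Id_in_Hom[OF H(6)]])
      (use Comp_assoc[OF H(2) s(1) H(2)] s(2) Comp_Id_left[OF H(2)] Comp_Id_right[OF H(2)] in simp)
  then show ?thesis using H(2) s unfolding isomorphic_def iso_arrow_def inverse_arrows_def by blast
qed

text \<open>
  The four ways in which vanishing propagates along a triangle \<open>A \<rightarrow> X \<rightarrow> B \<rightarrow> A[1]\<close>. Together they
  replace all arguments with closure under extensions, cones and cocones.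
\<close>

lemma orth_into_middle:
  assumes t: "dist_triangle D A X B f g h" and "orth W A" "orth W B" "W \<in> Obj D"
  shows "orth W X"
proof (rule orthI)
  note H = dist_Hom[OF t]
  fix u assume u: "u \<in> Hom D W X"
  then have "g \<cdot> u = Zero D W B" using Comp_in_Hom[OF u H(2)] assms by blast
  then obtain k where k: "k \<in> Hom D W A" "f \<cdot> k = u" using weak_kernel[OF t u] by blast
  then have "k = Zero D W A" using assms by blast
  then show "u = Zero D W X" using k Comp_Zero[OF H(1) assms(4)] by simp
qed (use assms dist_Hom[OF t] in blast)+

lemma orth_from_middle:
  assumes t: "dist_triangle D A X B f g h" and "orth A W" "orth B W" "W \<in> Obj D"
  shows "orth X W"
proof (rule orthI)
  note H = dist_Hom[OF t]
  fix u assume u: "u \<in> Hom D X W"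
  then have "u \<cdot> f = Zero D A W" using Comp_in_Hom[OF H(1) u] assms by blast
  then obtain k where k: "k \<in> Hom D B W" "k \<cdot> g = u" using weak_cokernel[OF t u] by blast
  then have "k = Zero D B W" using assms by blast
  then show "u = Zero D X W" using k Zero_Comp[OF H(2) assms(4)] by simp
qed (use assms dist_Hom[OF t] in blast)+

lemma orth_into_first:
  assumes t: "dist_triangle D A X B f g h" and "orth W X" "orth (Sh D W) B" "W \<in> Obj D"
  shows "orth W A"
proof (rule orthI)
  note H = dist_Hom[OF t]
  fix u assume u: "u \<in> Hom D W A"
  then have "f \<cdot> u = Zero D W X" using Comp_in_Hom[OF u H(1)] assms by blast
  then obtain k where k: "k \<in> Hom D (Sh D W) B" "h \<cdot> k = ShA D u" using weak_kernel_first[OF t u] by blast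
  then have "k = Zero D (Sh D W) B" using assms by blast
  then have "ShA D u = Zero D (Sh D W) (Sh D A)"
    using k Comp_Zero[OF H(3) Sh_in_Obj[OF assms(4)]] by simp
  then show "u = Zero D W A" using ShA_eq_Zero[OF u] by blast
qed (use assms dist_Hom[OF t] in blast)+

lemma orth_from_third:
  assumes t: "dist_triangle D A X B f g h" and "orth X W" "orth (Sh D A) W" "W \<in> Obj D"
  shows "orth B W"
proof (rule orthI)
  note H = dist_Hom[OF t]
  fix u assume u: "u \<in> Hom D B W"
  then have "u \<cdot> g = Zero D X W" using Comp_in_Hom[OF H(2) u] assms by blast
  then obtain k where k: "k \<in> Hom D (Sh D A) W" "k \<cdot> h = u" using weak_cokernel_second[OF t u] by blast
  then have "k = Zero D (Sh D A) W" using assms by blast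
  then show "u = Zero D B W" using k Zero_Comp[OF H(3) assms(4)] by simp
qed (use assms dist_Hom[OF t] in blast)+

section \<open>Associativity of extensions\<close>

text \<open>
  Two rotations change the sign of both shifted arrows, so \<open>f\<close> and \<open>g\<close> are chosen with
  \<open>f[1] = - v\<close> and \<open>g[1] = - w\<close>. A single backward rotation would need a desuspension of \<open>C\<close>.
\<close>

lemma dist_rotate_back_twice:
  assumes t: "dist_triangle D C (Sh D A) (Sh D B) h v w" and AB: "A \<in> Obj D" "B \<in> Obj D"
  obtains f g where "dist_triangle D A B C f g h"
proof -
  note H = dist_Hom[OF t]
  have C: "C \<in> Obj D" using H by blast
  obtain f where f: "f \<in> Hom D A B" "ShA D f = neg D (Sh D A) (Sh D B) v"
    using ShA_full[OF neg_in_Hom[OF H(2)] AB] .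
  obtain g where g: "g \<in> Hom D B C" "ShA D g = neg D (Sh D B) (Sh D C) w"
    using ShA_full[OF neg_in_Hom[OF H(3)] AB(2) C] .
  have "dist_triangle D C (Sh D A) (Sh D B) h (neg D (Sh D A) (Sh D B) (ShA D f))
      (neg D (Sh D B) (Sh D C) (ShA D g))"
    using t f g neg_neg[OF H(2)] neg_neg[OF H(3)] by simp
  moreover have "triangle D A B C f g h"
    and "triangle D B C (Sh D A) g h (neg D (Sh D A) (Sh D B) (ShA D f))"
    using f(1) g(1) H(1) neg_in_Hom[OF ShA_in_Hom[OF f(1)]] unfolding triangle_def by blast+
  ultimately show ?thesis using TR2 that by metis
qed

lemma iso_arrow_Id: "X \<in> Obj D \<Longrightarrow> iso_arrow D X X (Id D X)"
  unfolding iso_arrow_def inverse_arrows_def using Id_in_Hom[of X] Comp_Id_left[of "Id D X" X X] by blast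

lemma isomorphic_refl: "X \<in> Obj D \<Longrightarrow> isomorphic D X X"
  using iso_arrow_Id unfolding isomorphic_def by blast

lemma dist_replace_third:
  assumes t: "dist_triangle D X Y Z f g h" and Z: "isomorphic D Z Z'"
  obtains g' h' where "dist_triangle D X Y Z' f g' h'"
proof -
  note H = dist_Hom[OF t]
  obtain c d where c: "c \<in> Hom D Z Z'" and d: "d \<in> Hom D Z' Z" and dc: "d \<cdot> c = Id D Z" "c \<cdot> d = Id D Z'"
    using Z unfolding isomorphic_def iso_arrow_def inverse_arrows_def by blast
  have ic: "iso_arrow D Z Z' c" using c d dc unfolding iso_arrow_def inverse_arrows_def by blast
  have "dist_triangle D X Y Z' f (c \<cdot> g) (h \<cdot> d)"
  proof (rule TR1_iso[OF t _ iso_arrow_Id[OF H(4)] iso_arrow_Id[OF H(5)] ic])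
    show "triangle D X Y Z' f (c \<cdot> g) (h \<cdot> d)"
      unfolding triangle_def using Comp_in_Hom H c d by blast
    show "Id D Y \<cdot> f = f \<cdot> Id D X" using Comp_Id_left[OF H(1)] Comp_Id_right[OF H(1)] by simp
    show "c \<cdot> g = (c \<cdot> g) \<cdot> Id D Y" using Comp_Id_right[OF Comp_in_Hom[OF H(2) c]] by simp
    show "ShA D (Id D X) \<cdot> h = (h \<cdot> d) \<cdot> c"
      using ShA_Id[OF H(4)] Comp_Id_left[OF H(3)] Comp_assoc[OF c d H(3)] dc Comp_Id_right[OF H(3)] by simp
  qed
  then show ?thesis using that by blast
qed

text \<open>
  Every arrow \<open>Y \<rightarrow> X[1]\<close> classifies an extension of \<open>Y\<close> by \<open>X\<close>: the cone of the arrow is the shift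
  of the extension up to isomorphism, by essential surjectivity of the shift.
\<close>

lemma ex_dist_with_third:
  assumes w: "w \<in> Hom D Y (Sh D X)" and X: "X \<in> Obj D"
  obtains E f g where "dist_triangle D X E Y f g w"
proof -
  obtain C g h where t: "dist_triangle D Y (Sh D X) C w g h" using TR1_ex[OF w] by blast
  obtain E where E: "E \<in> Obj D" "isomorphic D (Sh D E) C" using Sh_ess_surj dist_Hom[OF t] by blast
  obtain g' h' where "dist_triangle D Y (Sh D X) (Sh D E) w g' h'"
    using dist_replace_third[OF t isomorphic_sym[OF E(2)]] .
  then show ?thesis using dist_rotate_back_twice[OF _ X E(1)] that by blast
qed

text \<open>
  If \<open>A\<close> is an extension of \<open>y\<close> by \<open>x\<close> and \<open>P\<close> one of \<open>z\<close> by \<open>A\<close>, the octahedron on \<open>x \<rightarrow> A \<rightarrow> P\<close> shows that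
  the cone of the composite is an extension of \<open>z\<close> by \<open>y\<close>.
\<close>

lemma star_assoc_le: "star D (star D X Y) Z \<subseteq> star D X (star D Y Z)"
proof
  fix P assume "P \<in> star D (star D X Y) Z"
  then obtain A x y z f f' f'' g g' g'' where xyz: "x \<in> X" "y \<in> Y" "z \<in> Z"
    and 1: "dist_triangle D x A y f f' f''" and 2: "dist_triangle D A P z g g' g''"
    unfolding star_def by blast
  obtain c h' h'' where 3: "dist_triangle D x P c (g \<cdot> f) h' h''"
    using TR1_ex[OF Comp_in_Hom] dist_Hom[OF 1] dist_Hom[OF 2] by blast
  have "c \<in> star D Y Z" using TR4[OF 1 2 3] xyz unfolding star_def by blast
  then show "P \<in> star D X (star D Y Z)" using 3 xyz unfolding star_def by blast
qed

text \<open>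
  If \<open>Q\<close> is an extension of \<open>z\<close> by \<open>y\<close> and \<open>P\<close> one of \<open>Q\<close> by \<open>x\<close>, the extension \<open>d\<close> of \<open>y\<close> by \<open>x\<close> is the
  pullback of \<open>P\<close> along \<open>y \<rightarrow> Q\<close>, that is, it is classified by \<open>y \<rightarrow> Q \<rightarrow> x[1]\<close>. The octahedron on
  this composite compares the cones \<open>z\<close>, \<open>P[1]\<close> and \<open>d[1]\<close>.
\<close>

lemma star_assoc_ge: "star D X (star D Y Z) \<subseteq> star D (star D X Y) Z"
proof
  fix P assume "P \<in> star D X (star D Y Z)"
  then obtain Q x y z f g h a b e where xyz: "x \<in> X" "y \<in> Y" "z \<in> Z"
    and 1: "dist_triangle D x P Q f g h" and 2: "dist_triangle D y Q z a b e"
    unfolding star_def by blast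
  note H1 = dist_Hom[OF 1] and H2 = dist_Hom[OF 2]
  obtain d i p where 3: "dist_triangle D x d y i p (h \<cdot> a)"
    using ex_dist_with_third[OF Comp_in_Hom[OF H2(1) H1(3)] H1(4)] .
  note H3 = dist_Hom[OF 3]
  obtain u v w where "dist_triangle D z (Sh D d) (Sh D P) u v w"
    using TR4[OF 2 dist_rotate[OF dist_rotate[OF 1]] dist_rotate[OF dist_rotate[OF 3]]] by blast
  then obtain k l where "dist_triangle D d P z k l u"
    using dist_rotate_back_twice[OF _ H3(5) H1(5)] by blast
  moreover have "d \<in> star D X Y" using 3 xyz unfolding star_def by blast
  ultimately show "P \<in> star D (star D X Y) Z" using xyz unfolding star_def by blast
qed

lemma star_mono: "\<lbrakk>X \<subseteq> X'; Y \<subseteq> Y'\<rbrakk> \<Longrightarrow> star D X Y \<subseteq> star D X' Y'"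
  unfolding star_def by blast

end


section \<open>Torsion pairs and t-structures\<close>

context triangulated_category
begin

text \<open>
  Up to isomorphism every object is a shift, so an orthogonality from shifted objects can be
  moved back by one degree.
\<close>

lemma ex_desuspension:
  assumes "W \<in> Obj D"
  obtains W' where "W' \<in> Obj D" "isomorphic D (Sh D W') W"
    "\<And>A. A \<in> Obj D \<Longrightarrow> orth (Sh D A) W \<longleftrightarrow> orth A W'"
proof -
  obtain W' where W': "W' \<in> Obj D" "isomorphic D (Sh D W') W" using Sh_ess_surj assms by blast
  have "orth (Sh D A) W \<longleftrightarrow> orth A W'" if "A \<in> Obj D" for A
    using orth_isomorphic_right[OF W'(2), of "Sh D A"] orth_Sh[OF that W'(1)]
      orth_isomorphic_right[OF isomorphic_sym[OF W'(2)], of "Sh D A"] Sh_in_Obj[OF that] by blast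
  then show ?thesis using that W' by blast
qed

lemma orth_Sh_from_middle:
  assumes t: "dist_triangle D A X B f g h" and "orth (Sh D A) W" "orth (Sh D B) W" "W \<in> Obj D"
  shows "orth (Sh D X) W"
proof -
  obtain W' where "W' \<in> Obj D" "\<And>A. A \<in> Obj D \<Longrightarrow> orth (Sh D A) W \<longleftrightarrow> orth A W'"
    by (rule ex_desuspension[OF assms(4)]) blast
  then show ?thesis using orth_from_middle[OF t] dist_Hom[OF t] assms by blast
qed

lemma Hom_vanishD: "\<lbrakk>Hom_vanish D X Y; A \<in> X; B \<in> Y\<rbrakk> \<Longrightarrow> orth A B"
  by (simp add: Hom_vanish_def)

lemma Hom_vanish_iff_left_perp: "X \<subseteq> Obj D \<Longrightarrow> Hom_vanish D X Y \<longleftrightarrow> X \<subseteq> left_perp Y"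
  unfolding Hom_vanish_def left_perp_def by auto

lemma Hom_vanish_iff_right_perp: "Y \<subseteq> Obj D \<Longrightarrow> Hom_vanish D X Y \<longleftrightarrow> Y \<subseteq> right_perp X"
  unfolding Hom_vanish_def right_perp_def by auto

lemma Hom_vanish_shift_neg:
  assumes F: "subcategory D F" and T: "T \<subseteq> Obj D"
  shows "Hom_vanish D T (shift_neg D F) \<longleftrightarrow> Hom_vanish D (Sh D ` T) F"
proof
  assume v: "Hom_vanish D T (shift_neg D F)"
  show "Hom_vanish D (Sh D ` T) F"
    unfolding Hom_vanish_def
  proof (intro ballI)
    fix A' B assume "A' \<in> Sh D ` T" and B: "B \<in> F"
    then obtain A where A: "A \<in> T" "A' = Sh D A" by blast
    have "B \<in> Obj D" using B F unfolding subcategory_def by blast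
    then obtain W where W: "W \<in> Obj D" "isomorphic D (Sh D W) B"
      "\<And>A. A \<in> Obj D \<Longrightarrow> orth (Sh D A) B \<longleftrightarrow> orth A W" by (rule ex_desuspension) blast
    have "Sh D W \<in> F" using F B isomorphic_sym[OF W(2)] unfolding subcategory_def by blast
    then have "orth A W" using Hom_vanishD[OF v A(1)] W(1) unfolding shift_neg_def by blast
    then show "orth A' B" using W(3) A T by blast
  qed
next
  assume v: "Hom_vanish D (Sh D ` T) F"
  show "Hom_vanish D T (shift_neg D F)"
    unfolding Hom_vanish_def
  proof (intro ballI)
    fix A B assume A: "A \<in> T" and "B \<in> shift_neg D F"
    then have B: "B \<in> Obj D" "Sh D B \<in> F" unfolding shift_neg_def by auto
    have "orth (Sh D A) (Sh D B)" using Hom_vanishD[OF v] A B by blast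
    then show "orth A B" using orth_Sh[OF _ B(1)] A T by blast
  qed
qed

lemma additive_Obj: "additive_subcategory D (Obj D) (Obj D)"
  using additive_left_perp[of "{}"] by (simp add: left_perp_def)

lemma torsion_pairD:
  assumes "torsion_pair D K (T, F)"
  shows "additive_subcategory D K T" "additive_subcategory D K F" "Hom_vanish D T F"
    and "X \<in> K \<Longrightarrow> \<exists>A\<in>T. \<exists>B\<in>F. \<exists>f g h. dist_triangle D A X B f g h"
  using assms unfolding torsion_pair_def star_def by auto

text \<open>
  If an object \<open>X\<close> of \<open>K\<close> has no arrows to \<open>F\<close>, then \<open>X \<rightarrow> B\<close> vanishes in its torsion triangle
  \<open>A \<rightarrow> X \<rightarrow> B\<close>, so \<open>X\<close> is a direct summand of \<open>A\<close> and hence in \<open>T\<close>; dually for \<open>F\<close>. Summands in \<open>T\<close> are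
  only taken inside \<open>K\<close>, so \<open>K\<close> has to contain the complement of \<open>X\<close>.
\<close>

lemma torsion_pair_perp:
  assumes tp: "torsion_pair D K (T, F)" and K: "additive_subcategory D (Obj D) K"
  shows "T = K \<inter> left_perp F" "F = K \<inter> right_perp T"
proof -
  note T = torsion_pairD(1)[OF tp] and F = torsion_pairD(2)[OF tp] and v = torsion_pairD(3)[OF tp]
  have "T \<subseteq> left_perp F" "F \<subseteq> right_perp T"
    using v Hom_vanish_iff_left_perp[OF additive_subcategoryD(2)[OF T]]
      Hom_vanish_iff_right_perp[OF additive_subcategoryD(2)[OF F]] by blast+
  moreover have "X \<in> T" if X: "X \<in> K" "X \<in> left_perp F" for X
  proof -
    obtain A B f g h where AB: "A \<in> T" "B \<in> F" and t: "dist_triangle D A X B f g h"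
      using torsion_pairD(4)[OF tp X(1)] by blast
    note H = dist_Hom[OF t]
    have "g = Zero D X B" using X(2) AB H(2) unfolding left_perp_def by blast
    then obtain s where "s \<in> Hom D X A" "f \<cdot> s = Id D X" using dist_second_Zero_retract[OF t] by blast
    then obtain B' where B': "B' \<in> Obj D" "direct_sum D X B' A" using split_epi_direct_sum[OF H(1)] by blast
    have "A \<in> K" using AB additive_subcategoryD(1)[OF T] by blast
    then have "B' \<in> K" using additive_subcategoryD(7)[OF K H(5) B'(1) _ B'(2)] by blast
    then show "X \<in> T" using additive_subcategoryD(7)[OF T X(1) _ AB(1) B'(2)] by blast
  qed
  moreover have "X \<in> F" if X: "X \<in> K" "X \<in> right_perp T" for X
  proof -
    obtain A B f g h where AB: "A \<in> T" "B \<in> F" and t: "dist_triangle D A X B f g h"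
      using torsion_pairD(4)[OF tp X(1)] by blast
    note H = dist_Hom[OF t]
    have "f = Zero D A X" using X(2) AB H(1) unfolding right_perp_def by blast
    then obtain s where "s \<in> Hom D B X" "s \<cdot> g = Id D X" using dist_first_Zero_retract[OF t] by blast
    then obtain B' where B': "B' \<in> Obj D" "direct_sum D X B' B" using split_epi_direct_sum[OF _ H(2)] by blast
    have "B \<in> K" using AB additive_subcategoryD(1)[OF F] by blast
    then have "B' \<in> K" using additive_subcategoryD(7)[OF K H(5) B'(1) _ B'(2)] by blast
    then show "X \<in> F" using additive_subcategoryD(7)[OF F X(1) _ AB(2) B'(2)] by blast
  qed
  ultimately show "T = K \<inter> left_perp F" "F = K \<inter> right_perp T"
    using additive_subcategoryD(1)[OF T] additive_subcategoryD(1)[OF F] by blast+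
qed

lemma torsion_pair_Obj_perp:
  assumes "torsion_pair D (Obj D) (U, V)" shows "U = left_perp V" "V = right_perp U"
  using torsion_pair_perp[OF assms additive_Obj] unfolding left_perp_def right_perp_def by blast+

lemma torsion_le_iff_vanish:
  assumes "T1 \<subseteq> Obj D" "subcategory D F2"
  shows "torsion_le D (T1, F1) (T2, F2) \<longleftrightarrow> Hom_vanish D T1 F2 \<and> Hom_vanish D (Sh D ` T1) F2"
  unfolding torsion_le_def using Hom_vanish_shift_neg[OF assms(2,1)] by simp

text \<open>
  Torsion classes are left complements of torsion-free classes, so vanishing into \<open>V2\<close> is inclusion
  in \<open>U2\<close>.
\<close>

lemma torsion_le_iff_subset:
  assumes 1: "torsion_pair D (Obj D) (U1, V1)" and 2: "torsion_pair D (Obj D) (U2, V2)"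
  shows "torsion_le D (U1, V1) (U2, V2) \<longleftrightarrow> U1 \<subseteq> U2 \<and> Sh D ` U1 \<subseteq> U2"
proof -
  have U1: "U1 \<subseteq> Obj D" and V2: "subcategory D V2"
    using additive_subcategoryD(2)[OF torsion_pairD(1)[OF 1]]
      additive_subcategoryD(3)[OF torsion_pairD(2)[OF 2]] .
  have "Hom_vanish D X V2 \<longleftrightarrow> X \<subseteq> U2" if "X \<subseteq> Obj D" for X
    using Hom_vanish_iff_left_perp[OF that, of V2] torsion_pair_Obj_perp(1)[OF 2] by simp
  moreover have "Sh D ` U1 \<subseteq> Obj D" using U1 Sh_in_Obj by blast
  ultimately show ?thesis using torsion_le_iff_vanish[OF U1 V2] U1 by simp
qed

text \<open>
  A t-structure is not assumed closed under direct summands, so the complements are computed from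
  the shift instead. If \<open>A\<close> has no arrows to \<open>Y[-1]\<close>, the second arrow of \<open>P \<rightarrow> A \<rightarrow> Q \<rightarrow> P[1]\<close> vanishes, so the
  identity of \<open>Q\<close> factors through \<open>P[1]\<close>, which lies in \<open>X\<close> and has no arrows to \<open>Q\<close>; thus \<open>Q\<close> is zero
  and \<open>A\<close> is isomorphic to \<open>P\<close>. Dually, if \<open>X\<close> has no arrows to \<open>A\<close>, the identity of \<open>P[1]\<close> factors through \<open>Q\<close>,
  so \<open>P\<close> is zero and \<open>A\<close> is isomorphic to \<open>Q\<close>.
\<close>

lemma t_structure_torsion_pair:
  assumes ts: "t_structure D (X, Y)"
  shows "torsion_pair D (Obj D) (X, shift_neg D Y)" "Sh D ` X \<subseteq> X" "subcategory D Y"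
proof -
  let ?V = "shift_neg D Y"
  have X: "subcategory D X" and Y: "subcategory D Y" and v: "Hom_vanish D X ?V"
    and st: "Obj D = star D X ?V" and sh: "X \<subseteq> shift_neg D X"
    using ts unfolding t_structure_def by auto
  show "subcategory D Y" by (fact Y)
  show ShX: "Sh D ` X \<subseteq> X" using sh unfolding shift_neg_def by blast
  have XO: "X \<subseteq> Obj D" and VO: "?V \<subseteq> Obj D"
    using X unfolding subcategory_def shift_neg_def by auto
  have iso_V: "B \<in> ?V" if "A \<in> ?V" "isomorphic D A B" for A B
    using that Y isomorphic_Sh[of A B] isomorphic_Obj[OF that(2)]
    unfolding shift_neg_def subcategory_def by blast
  have "A \<in> X" if A: "A \<in> left_perp ?V" for A
  proof -
    have "A \<in> star D X ?V" using A st unfolding left_perp_def by blast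
    then obtain P Q f g h where PQ: "P \<in> X" "Q \<in> ?V" and t: "dist_triangle D P A Q f g h"
      unfolding star_def by blast
    note H = dist_Hom[OF t]
    have "g = Zero D A Q" using A PQ H(2) unfolding left_perp_def by blast
    then have "Id D Q \<cdot> g = Zero D A Q" using Comp_Id_left[OF H(2)] by simp
    then obtain k where k: "k \<in> Hom D (Sh D P) Q" "k \<cdot> h = Id D Q"
      using weak_cokernel_second[OF t Id_in_Hom[OF H(6)]] by blast
    have "orth (Sh D P) Q" using Hom_vanishD[OF v] PQ ShX by blast
    then have "Id D Q = Zero D Q Q" using k Zero_Comp[OF H(3) H(6)] by auto
    then have "isomorphic D P A"
      using dist_third_zero_object_isomorphic[OF t] H(6) zero_object_iff by blast
    then show "A \<in> X" using X PQ(1) unfolding subcategory_def by blast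
  qed
  then have X_eq: "X = left_perp ?V"
    using Hom_vanish_iff_left_perp[OF XO, of ?V] v by (intro equalityI subsetI) auto
  have "A \<in> ?V" if A: "A \<in> right_perp X" for A
  proof -
    have "A \<in> star D X ?V" using A st unfolding right_perp_def by blast
    then obtain P Q f g h where PQ: "P \<in> X" "Q \<in> ?V" and t: "dist_triangle D P A Q f g h"
      unfolding star_def by blast
    note H = dist_Hom[OF t]
    have "f = Zero D P A" using A PQ H(1) unfolding right_perp_def by blast
    then have "f \<cdot> Id D P = Zero D P A" using Comp_Id_right[OF H(1)] by simp
    then obtain k where k: "k \<in> Hom D (Sh D P) Q" "h \<cdot> k = Id D (Sh D P)"
      using weak_kernel_first[OF t Id_in_Hom[OF H(4)]] ShA_Id[OF H(4)] by metis
    have "orth (Sh D P) Q" using Hom_vanishD[OF v] PQ ShX by blast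
    then have "Id D (Sh D P) = Zero D (Sh D P) (Sh D P)"
      using k Comp_Zero[OF H(3) Sh_in_Obj[OF H(4)]] by auto
    then have "zero_object D P" using zero_object_Sh[OF H(4)] zero_object_iff Sh_in_Obj[OF H(4)] by blast
    then show "A \<in> ?V" using dist_first_zero_object_isomorphic[OF t] iso_V PQ(2) by blast
  qed
  then have V_eq: "?V = right_perp X"
    using Hom_vanish_iff_right_perp[OF VO, of X] v by (intro equalityI subsetI) auto
  show "torsion_pair D (Obj D) (X, ?V)"
    unfolding torsion_pair_def prod.case
  proof (intro conjI)
    show "additive_subcategory D (Obj D) X" using additive_left_perp[OF VO] unfolding X_eq[symmetric] .
    show "additive_subcategory D (Obj D) ?V" using additive_right_perp[OF XO] unfolding V_eq[symmetric] .
    show "Obj D \<subseteq> star D X ?V" using equalityD1[OF st] .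
  qed (fact v)
qed

lemma shift_pos_shift_neg:
  assumes "subcategory D Y" shows "shift_pos D (shift_neg D Y) = Y"
proof
  show "shift_pos D (shift_neg D Y) \<subseteq> Y"
    using assms unfolding shift_pos_def shift_neg_def subcategory_def by blast
  show "Y \<subseteq> shift_pos D (shift_neg D Y)"
  proof
    fix A assume A: "A \<in> Y"
    then obtain B where B: "B \<in> Obj D" "isomorphic D (Sh D B) A"
      using Sh_ess_surj assms unfolding subcategory_def by blast
    have "Sh D B \<in> Y" using A isomorphic_sym[OF B(2)] assms unfolding subcategory_def by blast
    then show "A \<in> shift_pos D (shift_neg D Y)" using B unfolding shift_pos_def shift_neg_def by blast
  qed
qed

lemma shift_neg_shift_pos:
  assumes "subcategory D V" shows "shift_neg D (shift_pos D V) = V"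
proof
  show "shift_neg D (shift_pos D V) \<subseteq> V"
  proof
    fix A assume "A \<in> shift_neg D (shift_pos D V)"
    then obtain B where B: "B \<in> V" "isomorphic D (Sh D B) (Sh D A)" "A \<in> Obj D"
      unfolding shift_pos_def shift_neg_def by blast
    then have "B \<in> Obj D" using assms unfolding subcategory_def by blast
    then have "isomorphic D B A" using isomorphic_Sh[OF _ B(3)] B(2) by blast
    then show "A \<in> V" using B(1) assms unfolding subcategory_def by blast
  qed
  show "V \<subseteq> shift_neg D (shift_pos D V)"
  proof
    fix A assume A: "A \<in> V"
    then have "A \<in> Obj D" using assms unfolding subcategory_def by blast
    moreover have "isomorphic D (Sh D A) (Sh D A)"
      using isomorphic_refl[OF Sh_in_Obj[OF calculation]] .
    ultimately show "A \<in> shift_neg D (shift_pos D V)" using A unfolding shift_pos_def shift_neg_def by blast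
  qed
qed

text \<open>
  The coaisle in degrees at least 0 is recovered as \<open>V[1]\<close>. It contains \<open>V\<close>: an object of \<open>V\<close> receives no
  arrows from \<open>U[1] \<subseteq> U\<close>, so its negative shift receives none from \<open>U\<close> and lies in \<open>V\<close>.
\<close>

lemma torsion_pair_t_structure:
  assumes tp: "torsion_pair D (Obj D) (U, V)" and sh: "Sh D ` U \<subseteq> U"
  shows "t_structure D (U, shift_pos D V)" "shift_neg D (shift_pos D V) = V"
proof -
  note U = torsion_pairD(1)[OF tp] and V = torsion_pairD(2)[OF tp] and v = torsion_pairD(3)[OF tp]
  have sU: "subcategory D U" and sV: "subcategory D V"
    using additive_subcategoryD(3)[OF U] additive_subcategoryD(3)[OF V] .
  show *: "shift_neg D (shift_pos D V) = V" using shift_neg_shift_pos[OF sV] .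
  have UO: "U \<subseteq> Obj D" and VO: "V \<subseteq> Obj D" using sU sV unfolding subcategory_def by auto
  have "B \<in> shift_pos D V" if "A \<in> shift_pos D V" "isomorphic D A B" for A B
  proof -
    obtain C where C: "C \<in> V" "isomorphic D (Sh D C) A" using \<open>A \<in> shift_pos D V\<close> unfolding shift_pos_def by blast
    then have "isomorphic D (Sh D C) B" using isomorphic_trans that(2) by blast
    then show ?thesis using C unfolding shift_pos_def by blast
  qed
  moreover have "shift_pos D V \<subseteq> Obj D" unfolding shift_pos_def using isomorphic_Obj by blast
  ultimately have sP: "subcategory D (shift_pos D V)" unfolding subcategory_def by blast
  have st: "Obj D = star D U V"
  proof (rule equalityI)
    show "Obj D \<subseteq> star D U V" using tp unfolding torsion_pair_def by blast
    show "star D U V \<subseteq> Obj D" unfolding star_def using dist_Hom(5) by blast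
  qed
  have "V \<subseteq> shift_pos D V"
  proof
    fix A assume A: "A \<in> V"
    then have "A \<in> Obj D" using VO by blast
    then obtain W where W: "W \<in> Obj D" "isomorphic D (Sh D W) A"
      "\<And>B. B \<in> Obj D \<Longrightarrow> orth (Sh D B) A \<longleftrightarrow> orth B W" by (rule ex_desuspension) blast
    have "orth B W" if "B \<in> U" for B
      using W(3)[of B] Hom_vanishD[OF v _ A] that UO sh by blast
    then have "W \<in> V"
      using W(1) unfolding torsion_pair_Obj_perp(2)[OF tp] right_perp_def by blast
    then show "A \<in> shift_pos D V" using W(2) unfolding shift_pos_def by blast
  qed
  moreover have "U \<subseteq> shift_neg D U" using UO sh unfolding shift_neg_def by blast
  ultimately show "t_structure D (U, shift_pos D V)"
    unfolding t_structure_def prod.case * using sU sP v st by (intro conjI)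
qed

end

section \<open>Order preserving bijections\<close>

lemma inverse_order_bijectionsI:
  assumes "\<And>a. a \<in> A \<Longrightarrow> \<phi> a \<in> B" "\<And>b. b \<in> B \<Longrightarrow> \<psi> b \<in> A"
    and "\<And>a. a \<in> A \<Longrightarrow> \<psi> (\<phi> a) = a" "\<And>b. b \<in> B \<Longrightarrow> \<phi> (\<psi> b) = b"
    and "\<And>a a'. \<lbrakk>a \<in> A; a' \<in> A; leA a a'\<rbrakk> \<Longrightarrow> leB (\<phi> a) (\<phi> a')"
    and "\<And>b b'. \<lbrakk>b \<in> B; b' \<in> B; leB b b'\<rbrakk> \<Longrightarrow> leA (\<psi> b) (\<psi> b')"
  shows "inverse_order_bijections A leA B leB \<phi> \<psi>"
  unfolding inverse_order_bijections_def monotone_on_def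
  using assms bij_betw_byWitness[of A \<psi> \<phi> B] bij_betw_byWitness[of B \<phi> \<psi> A] by blast

lemma inverse_order_bijectionsD:
  assumes "inverse_order_bijections A leA B leB \<phi> \<psi>"
  shows "a \<in> A \<Longrightarrow> \<phi> a \<in> B" "b \<in> B \<Longrightarrow> \<psi> b \<in> A"
    and "a \<in> A \<Longrightarrow> \<psi> (\<phi> a) = a" "b \<in> B \<Longrightarrow> \<phi> (\<psi> b) = b"
    and "\<lbrakk>a \<in> A; a' \<in> A; leA a a'\<rbrakk> \<Longrightarrow> leB (\<phi> a) (\<phi> a')"
    and "\<lbrakk>b \<in> B; b' \<in> B; leB b b'\<rbrakk> \<Longrightarrow> leA (\<psi> b) (\<psi> b')"
  using assms unfolding inverse_order_bijections_def monotone_on_def bij_betw_def by blast+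

text \<open>
  The relations need not be reflexive, and both maps preserve them, so the elements related to
  themselves correspond to each other. This is how statements on torsion pairs yield
  statements on s-torsion pairs and t-structures.
\<close>

lemma inverse_order_bijections_reflexive_part:
  assumes "inverse_order_bijections A leA B leB \<phi> \<psi>"
  shows "inverse_order_bijections {a \<in> A. leA a a} leA {b \<in> B. leB b b} leB \<phi> \<psi>"
  by (rule inverse_order_bijectionsI) (use inverse_order_bijectionsD[OF assms] in blast)+

lemma inverse_order_bijections_comp:
  assumes 1: "inverse_order_bijections A leA B leB \<phi> \<psi>"
    and 2: "inverse_order_bijections B leB C leC \<phi>' \<psi>'"
  shows "inverse_order_bijections A leA C leC (\<phi>' \<circ> \<phi>) (\<psi> \<circ> \<psi>')"
  by (rule inverse_order_bijectionsI)
    (simp_all add: inverse_order_bijectionsD[OF 1] inverse_order_bijectionsD[OF 2])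

section \<open>Intervals of torsion pairs\<close>

locale torsion_interval = triangulated_category D
  for D :: "('o, 'm, 'x) triangulated_data_scheme" (structure) +
  fixes U1 V1 U2 V2 :: "'o set"
  assumes lower: "torsion_pair D (Obj D) (U1, V1)"
    and upper: "torsion_pair D (Obj D) (U2, V2)"
    and lower_le_upper: "torsion_le D (U1, V1) (U2, V2)"
begin

abbreviation heart :: "'o set" where
  "heart \<equiv> U2 \<inter> V1"

definition interval :: "('o set \<times> 'o set) set" where
  "interval = {(U, V). torsion_pair D (Obj D) (U, V) \<and>
     torsion_le D (U1, V1) (U, V) \<and> torsion_le D (U, V) (U2, V2)}"

definition heart_pairs :: "('o set \<times> 'o set) set" where
  "heart_pairs = {(T, F). torsion_pair D heart (T, F) \<and>
     shift_pos D T \<subseteq> U2 \<and> shift_neg D F \<subseteq> V1}"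

definition to_heart :: "'o set \<times> 'o set \<Rightarrow> 'o set \<times> 'o set" where
  "to_heart = (\<lambda>(U, V). (U \<inter> V1, U2 \<inter> V))"

text \<open>
  The components are \<open>U1 * T\<close> and \<open>F * V2\<close> on the pairs of interest; as orthogonal complements they
  are additive subcategories and closed under summands by construction.
\<close>

definition from_heart :: "'o set \<times> 'o set \<Rightarrow> 'o set \<times> 'o set" where
  "from_heart = (\<lambda>(T, F). (left_perp (F \<union> V2), right_perp (U1 \<union> T)))"

lemma additive_components:
  "additive_subcategory D (Obj D) U1" "additive_subcategory D (Obj D) V1"
  "additive_subcategory D (Obj D) U2" "additive_subcategory D (Obj D) V2"
  using torsion_pairD(1,2)[OF lower] torsion_pairD(1,2)[OF upper] .

lemma components_Obj: "U1 \<subseteq> Obj D" "V1 \<subseteq> Obj D" "U2 \<subseteq> Obj D" "V2 \<subseteq> Obj D"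
  using additive_components[THEN additive_subcategoryD(1)] .

lemma V1_eq: "V1 = right_perp U1" and U2_eq: "U2 = left_perp V2"
  using torsion_pair_Obj_perp[OF lower] torsion_pair_Obj_perp[OF upper] by blast+

lemma U1_subset: "U1 \<subseteq> U2" "Sh D ` U1 \<subseteq> U2"
  using torsion_le_iff_subset[OF lower upper] lower_le_upper by blast+

lemma additive_heart: "additive_subcategory D (Obj D) heart"
  using additive_Int[OF additive_components(3,2)] components_Obj by blast

lemma interval_iff:
  "(U, V) \<in> interval \<longleftrightarrow> torsion_pair D (Obj D) (U, V) \<and>
     U1 \<subseteq> U \<and> Sh D ` U1 \<subseteq> U \<and> U \<subseteq> U2 \<and> Sh D ` U \<subseteq> U2"
  unfolding interval_def
  using torsion_le_iff_subset[OF lower, of U V] torsion_le_iff_subset[OF _ upper, of U V] by blast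

text \<open>
  The conditions on \<open>T[1]\<close> and \<open>F[-1]\<close> without closure under isomorphisms and negative shifts: an object
  lies in \<open>V1\<close> if and only if it receives no arrows from \<open>U1\<close>.
\<close>

lemma heart_pairs_iff:
  "(T, F) \<in> heart_pairs \<longleftrightarrow> torsion_pair D heart (T, F) \<and>
     Sh D ` T \<subseteq> U2 \<and> Hom_vanish D (Sh D ` U1) F"
proof -
  have "(shift_pos D T \<subseteq> U2 \<longleftrightarrow> Sh D ` T \<subseteq> U2) \<and>
      (shift_neg D F \<subseteq> V1 \<longleftrightarrow> Hom_vanish D (Sh D ` U1) F)" if tp: "torsion_pair D heart (T, F)"
  proof
    have T: "T \<subseteq> Obj D" and F: "subcategory D F"
      using additive_subcategoryD(2)[OF torsion_pairD(1)[OF tp]]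
        additive_subcategoryD(3)[OF torsion_pairD(2)[OF tp]] by blast+
    have "shift_pos D T \<subseteq> U2" if "Sh D ` T \<subseteq> U2"
      using that additive_subcategoryD(4)[OF additive_components(3)] unfolding shift_pos_def by blast
    moreover have "Sh D ` T \<subseteq> shift_pos D T"
      using isomorphic_refl[OF Sh_in_Obj] T unfolding shift_pos_def by blast
    ultimately show "shift_pos D T \<subseteq> U2 \<longleftrightarrow> Sh D ` T \<subseteq> U2" by blast
    have "shift_neg D F \<subseteq> Obj D" unfolding shift_neg_def by blast
    then have "shift_neg D F \<subseteq> V1 \<longleftrightarrow> Hom_vanish D U1 (shift_neg D F)"
      using Hom_vanish_iff_right_perp V1_eq by metis
    then show "shift_neg D F \<subseteq> V1 \<longleftrightarrow> Hom_vanish D (Sh D ` U1) F"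
      using Hom_vanish_shift_neg[OF F components_Obj(1)] by simp
  qed
  then show ?thesis unfolding heart_pairs_def by blast
qed

text \<open>
  For \<open>X\<close> in the heart with triangle \<open>A \<rightarrow> X \<rightarrow> B\<close>, the object \<open>A\<close> is in \<open>V1\<close> since \<open>U1\<close> has no arrows to \<open>X\<close> and
  \<open>U1[1] \<subseteq> U\<close> has none to \<open>B\<close>; the object \<open>B\<close> is in \<open>U2\<close> since neither \<open>X\<close> nor \<open>A[1]\<close> has arrows to \<open>V2\<close>.
\<close>

lemma to_heart_in_heart_pairs:
  assumes "(U, V) \<in> interval" shows "to_heart (U, V) \<in> heart_pairs"
proof -
  have tp: "torsion_pair D (Obj D) (U, V)" and sub: "U1 \<subseteq> U" "Sh D ` U1 \<subseteq> U" "U \<subseteq> U2" "Sh D ` U \<subseteq> U2"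
    using assms unfolding interval_iff by blast+
  note v = torsion_pairD(3)[OF tp]
  have "V \<subseteq> right_perp U"
    using v Hom_vanish_iff_right_perp[OF additive_subcategoryD(2)[OF torsion_pairD(2)[OF tp]]] by blast
  then have VV1: "V \<subseteq> V1" using sub(1) unfolding V1_eq right_perp_def by blast
  have "torsion_pair D heart (U \<inter> V1, U2 \<inter> V)"
    unfolding torsion_pair_def prod.case
  proof (intro conjI subsetI)
    show "additive_subcategory D heart (U \<inter> V1)"
      by (rule additive_Int[OF torsion_pairD(1)[OF tp] additive_components(2)]) (use sub components_Obj in auto)
    show "additive_subcategory D heart (U2 \<inter> V)"
      by (rule additive_Int[OF additive_components(3) torsion_pairD(2)[OF tp]]) (use VV1 components_Obj in auto)
    show "Hom_vanish D (U \<inter> V1) (U2 \<inter> V)" using v unfolding Hom_vanish_def by blast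
    fix X assume X: "X \<in> heart"
    then obtain A B f g h where AB: "A \<in> U" "B \<in> V" and t: "dist_triangle D A X B f g h"
      using torsion_pairD(4)[OF tp] components_Obj by blast
    note H = dist_Hom[OF t]
    have "orth W A" if W: "W \<in> U1" for W
    proof (rule orth_into_first[OF t])
      show "orth W X" using X W unfolding V1_eq right_perp_def by blast
      show "orth (Sh D W) B" using Hom_vanishD[OF v _ AB(2)] sub(2) W by blast
      show "W \<in> Obj D" using W components_Obj by blast
    qed
    then have A: "A \<in> V1" using H(4) unfolding V1_eq right_perp_def by blast
    have "orth B W" if W: "W \<in> V2" for W
    proof (rule orth_from_third[OF t])
      show "orth X W" using X W unfolding U2_eq left_perp_def by blast
      have "Sh D A \<in> U2" using sub(4) AB by blast
      then show "orth (Sh D A) W" using W unfolding U2_eq left_perp_def by blast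
      show "W \<in> Obj D" using W components_Obj by blast
    qed
    then have "B \<in> U2" using H(6) unfolding U2_eq left_perp_def by blast
    then show "X \<in> star D (U \<inter> V1) (U2 \<inter> V)" using t A AB unfolding star_def by blast
  qed
  moreover have "Hom_vanish D (Sh D ` U1) (U2 \<inter> V)" using v sub(2) unfolding Hom_vanish_def by blast
  ultimately show ?thesis unfolding to_heart_def prod.case heart_pairs_iff using sub(4) by blast
qed

text \<open>
  The part of \<open>X\<close> in \<open>U2\<close> stays in \<open>V1\<close>, because \<open>U1[1] \<subseteq> U2\<close> has no arrows to \<open>V2\<close>.
\<close>

lemma V1_subset_star: "V1 \<subseteq> star D heart V2"
proof
  fix X assume X: "X \<in> V1"
  then obtain A B f g h where AB: "A \<in> U2" "B \<in> V2" and t: "dist_triangle D A X B f g h"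
    using torsion_pairD(4)[OF upper] components_Obj by blast
  have "orth W A" if W: "W \<in> U1" for W
  proof (rule orth_into_first[OF t])
    show "orth W X" using X W unfolding V1_eq right_perp_def by blast
    have "Sh D W \<in> U2" using U1_subset W by blast
    then show "orth (Sh D W) B" using AB unfolding U2_eq left_perp_def by blast
    show "W \<in> Obj D" using W components_Obj by blast
  qed
  then have "A \<in> V1" using dist_Hom(4)[OF t] unfolding V1_eq right_perp_def by blast
  then show "X \<in> star D heart V2" using t AB unfolding star_def by blast
qed

text \<open>
  All the vanishing between the pieces \<open>U1\<close>, \<open>T\<close> and \<open>F\<close>, \<open>V2\<close> that the construction of \<open>from_heart\<close> needs,
  in degree 0 and after one shift. Only between \<open>T[1]\<close> and \<open>F\<close> can there be arrows: vanishing there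
  characterises s-torsion pairs.
\<close>

lemma heart_pair_facts:
  assumes "(T, F) \<in> heart_pairs"
  shows "T = heart \<inter> left_perp F" "F = heart \<inter> right_perp T" "T \<subseteq> Obj D" "F \<subseteq> Obj D"
    and "T \<subseteq> heart" "F \<subseteq> heart" "Sh D ` T \<subseteq> U2"
    and "\<lbrakk>A \<in> U1 \<union> T; B \<in> F \<union> V2\<rbrakk> \<Longrightarrow> orth A B"
    and "\<lbrakk>A \<in> U1; B \<in> F \<union> V2\<rbrakk> \<Longrightarrow> orth (Sh D A) B"
    and "\<lbrakk>A \<in> T; B \<in> V2\<rbrakk> \<Longrightarrow> orth (Sh D A) B"
proof -
  have tp: "torsion_pair D heart (T, F)" and T2: "Sh D ` T \<subseteq> U2" and v: "Hom_vanish D (Sh D ` U1) F"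
    using assms unfolding heart_pairs_iff by blast+
  show *: "T = heart \<inter> left_perp F" "F = heart \<inter> right_perp T" using torsion_pair_perp[OF tp additive_heart] .
  show **: "T \<subseteq> heart" "F \<subseteq> heart" using * by blast+
  then show "T \<subseteq> Obj D" "F \<subseteq> Obj D" using components_Obj by blast+
  show "Sh D ` T \<subseteq> U2" by (fact T2)
  have o: "orth A B" if "A \<in> U2" "B \<in> V2" for A B using that unfolding U2_eq left_perp_def by blast
  have o': "orth A B" if "A \<in> U1" "B \<in> V1" for A B using that unfolding V1_eq right_perp_def by blast
  show "orth A B" if AB: "A \<in> U1 \<union> T" "B \<in> F \<union> V2"
  proof (cases "B \<in> V2")
    case True
    then show ?thesis using o AB(1) U1_subset ** by blast
  next
    case False
    then have "B \<in> F" using AB by blast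
    then show ?thesis using o' AB(1) ** Hom_vanishD[OF torsion_pairD(3)[OF tp]] by blast
  qed
  show "orth (Sh D A) B" if "A \<in> U1" "B \<in> F \<union> V2"
    using that o[of "Sh D A" B] U1_subset Hom_vanishD[OF v, of "Sh D A" B] by blast
  show "orth (Sh D A) B" if "A \<in> T" "B \<in> V2" using that o[of "Sh D A" B] T2 by blast
qed

text \<open>
  Let \<open>A \<rightarrow> X \<rightarrow> B\<close> be the triangle of \<open>X\<close> for \<open>(U1, V1)\<close>. Neither \<open>X\<close> nor \<open>A[1]\<close> has arrows to \<open>F\<close> or \<open>V2\<close>, where for
  \<open>A[1]\<close> and \<open>F\<close> this is the condition on \<open>F[-1]\<close>. So \<open>B\<close> has none either: it lies in \<open>U2\<close>, hence in the
  heart, and there in the left complement \<open>T\<close> of \<open>F\<close>.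
\<close>

lemma left_perp_subset_star:
  assumes "(T, F) \<in> heart_pairs" shows "left_perp (F \<union> V2) \<subseteq> star D U1 T"
proof
  note facts = heart_pair_facts[OF assms]
  fix X assume X: "X \<in> left_perp (F \<union> V2)"
  then obtain A B f g h where AB: "A \<in> U1" "B \<in> V1" and t: "dist_triangle D A X B f g h"
    using torsion_pairD(4)[OF lower] unfolding left_perp_def by blast
  have "orth B W" if W: "W \<in> F \<union> V2" for W
  proof (rule orth_from_third[OF t])
    show "orth X W" using X W unfolding left_perp_def by blast
    show "orth (Sh D A) W" using facts(9) AB W by blast
    show "W \<in> Obj D" using W facts(4) components_Obj by blast
  qed
  then have "B \<in> U2" "B \<in> left_perp F" using dist_Hom(6)[OF t] unfolding U2_eq left_perp_def by blast+
  then have "B \<in> T" using facts(1) AB by blast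
  then show "X \<in> star D U1 T" using t AB unfolding star_def by blast
qed

text \<open>
  Hom vanishing follows since the left complement is built from \<open>U1\<close> and \<open>T\<close>. The
  required triangles come from grouping the four pieces of an object by associativity of extensions.
\<close>

lemma from_heart_in_interval:
  assumes hp: "(T, F) \<in> heart_pairs" shows "from_heart (T, F) \<in> interval"
proof -
  note facts = heart_pair_facts[OF hp]
  let ?U = "left_perp (F \<union> V2)" and ?V = "right_perp (U1 \<union> T)"
  have FV: "F \<union> V2 \<subseteq> Obj D" and UT: "U1 \<union> T \<subseteq> Obj D" using facts(3,4) components_Obj by blast+
  have star_U: "star D U1 T \<subseteq> ?U"
  proof
    fix X assume "X \<in> star D U1 T"
    then obtain A B f g h where AB: "A \<in> U1" "B \<in> T" and t: "dist_triangle D A X B f g h"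
      unfolding star_def by blast
    have "orth X W" if "W \<in> F \<union> V2" for W
      using orth_from_middle[OF t, of W] facts(8) AB that FV by blast
    then show "X \<in> ?U" using dist_Hom(5)[OF t] unfolding left_perp_def by blast
  qed
  have star_V: "star D F V2 \<subseteq> ?V"
  proof
    fix X assume "X \<in> star D F V2"
    then obtain A B f g h where AB: "A \<in> F" "B \<in> V2" and t: "dist_triangle D A X B f g h"
      unfolding star_def by blast
    have "orth W X" if "W \<in> U1 \<union> T" for W
      using orth_into_middle[OF t, of W] facts(8) AB that UT by blast
    then show "X \<in> ?V" using dist_Hom(5)[OF t] unfolding right_perp_def by blast
  qed
  have "Hom_vanish D ?U ?V"
    unfolding Hom_vanish_def
  proof (intro ballI)
    fix X Y assume X: "X \<in> ?U" and Y: "Y \<in> ?V"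
    obtain A B f g h where AB: "A \<in> U1" "B \<in> T" and t: "dist_triangle D A X B f g h"
      using X left_perp_subset_star[OF hp] unfolding star_def by blast
    show "orth X Y" using orth_from_middle[OF t, of Y] AB Y unfolding right_perp_def by blast
  qed
  moreover have "Obj D \<subseteq> star D ?U ?V"
  proof -
    \<comment> \<open>The grouping changes from \<open>U1 * ((T * F) * V2)\<close> to \<open>(U1 * T) * (F * V2)\<close>.\<close>
    have "heart \<subseteq> star D T F" using hp unfolding heart_pairs_iff torsion_pair_def by blast
    then have "V1 \<subseteq> star D (star D T F) V2" using V1_subset_star star_mono by blast
    then have "V1 \<subseteq> star D T (star D F V2)" using star_assoc_le by blast
    moreover have "Obj D \<subseteq> star D U1 V1" using lower unfolding torsion_pair_def by blast
    ultimately have "Obj D \<subseteq> star D U1 (star D T (star D F V2))" using star_mono by blast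
    then have "Obj D \<subseteq> star D (star D U1 T) (star D F V2)" using star_assoc_ge by blast
    then show ?thesis using star_mono[OF star_U star_V] by blast
  qed
  ultimately have "torsion_pair D (Obj D) (?U, ?V)"
    unfolding torsion_pair_def using additive_left_perp[OF FV] additive_right_perp[OF UT] by simp
  moreover have "U1 \<subseteq> ?U" "Sh D ` U1 \<subseteq> ?U"
    using facts(8,9) components_Obj Sh_in_Obj unfolding left_perp_def by blast+
  moreover have "?U \<subseteq> U2" unfolding U2_eq left_perp_def by blast
  moreover have "Sh D X \<in> U2" if X: "X \<in> ?U" for X
  proof -
    obtain A B f g h where AB: "A \<in> U1" "B \<in> T" and t: "dist_triangle D A X B f g h"
      using X left_perp_subset_star[OF hp] unfolding star_def by blast
    have "orth (Sh D X) W" if "W \<in> V2" for W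
      using orth_Sh_from_middle[OF t, of W] facts(9,10) AB that FV by blast
    then show ?thesis using Sh_in_Obj dist_Hom(5)[OF t] unfolding U2_eq left_perp_def by blast
  qed
  ultimately show ?thesis unfolding from_heart_def prod.case interval_iff by blast
qed

text \<open>
  Both are torsion pairs of the whole category, so it suffices to compare the torsion classes; one
  inclusion uses that \<open>U\<close> is closed under extensions.
\<close>

lemma from_heart_to_heart:
  assumes "(U, V) \<in> interval" shows "from_heart (to_heart (U, V)) = (U, V)"
proof -
  have tp: "torsion_pair D (Obj D) (U, V)" and sub: "U1 \<subseteq> U" "Sh D ` U1 \<subseteq> U" "U \<subseteq> U2" "Sh D ` U \<subseteq> U2"
    using assms unfolding interval_iff by blast+
  have hp: "(U \<inter> V1, U2 \<inter> V) \<in> heart_pairs"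
    using to_heart_in_heart_pairs[OF assms] unfolding to_heart_def by simp
  let ?U = "left_perp ((U2 \<inter> V) \<union> V2)" and ?V = "right_perp (U1 \<union> (U \<inter> V1))"
  have tp': "torsion_pair D (Obj D) (?U, ?V)"
    using from_heart_in_interval[OF hp] unfolding from_heart_def prod.case interval_iff by blast
  have U: "U = left_perp V" using torsion_pair_Obj_perp[OF tp] by blast
  have "U \<subseteq> ?U" using sub(3) U unfolding U2_eq left_perp_def by blast
  moreover have "?U \<subseteq> U"
  proof
    fix X assume "X \<in> ?U"
    then obtain A B f g h where AB: "A \<in> U1" "B \<in> U \<inter> V1" and t: "dist_triangle D A X B f g h"
      using left_perp_subset_star[OF hp] unfolding star_def by blast
    have "orth X W" if "W \<in> V" for W
      using orth_from_middle[OF t, of W] AB sub(1) that U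
        additive_subcategoryD(2)[OF torsion_pairD(2)[OF tp]] unfolding left_perp_def by blast
    then show "X \<in> U" using dist_Hom(5)[OF t] unfolding U left_perp_def by blast
  qed
  ultimately have "?U = U" by blast
  moreover have "?V = V"
    using torsion_pair_Obj_perp(2)[OF tp'] torsion_pair_Obj_perp(2)[OF tp] calculation by simp
  ultimately show ?thesis unfolding to_heart_def from_heart_def by simp
qed

text \<open>
  Inside the heart, the conditions coming from \<open>U1\<close> and \<open>V2\<close> hold already.
\<close>

lemma to_heart_from_heart:
  assumes "(T, F) \<in> heart_pairs" shows "to_heart (from_heart (T, F)) = (T, F)"
proof -
  note facts = heart_pair_facts[OF assms]
  have "left_perp (F \<union> V2) \<inter> V1 = U2 \<inter> V1 \<inter> left_perp F"
    unfolding U2_eq left_perp_def by blast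
  moreover have "U2 \<inter> right_perp (U1 \<union> T) = U2 \<inter> V1 \<inter> right_perp T"
    unfolding V1_eq right_perp_def by blast
  ultimately show ?thesis
    unfolding to_heart_def from_heart_def prod.case facts(1,2)[symmetric] by simp
qed

lemma to_heart_mono:
  assumes "(U, V) \<in> interval" "(U', V') \<in> interval" "torsion_le D (U, V) (U', V')"
  shows "torsion_le D (to_heart (U, V)) (to_heart (U', V'))"
  using assms(3) unfolding to_heart_def torsion_le_def Hom_vanish_def shift_neg_def prod.case by blast

text \<open>
  In the whole category the relation says that the torsion class and its shift lie in the larger
  torsion class. This can be tested on the two pieces, in \<open>U1\<close> and \<open>T\<close>, of an object.
\<close>

lemma from_heart_mono:
  assumes hp: "(T, F) \<in> heart_pairs" and hp': "(T', F') \<in> heart_pairs"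
    and le: "torsion_le D (T, F) (T', F')"
  shows "torsion_le D (from_heart (T, F)) (from_heart (T', F'))"
proof -
  note facts = heart_pair_facts[OF hp] and facts' = heart_pair_facts[OF hp']
  let ?U = "left_perp (F \<union> V2)" and ?V = "right_perp (U1 \<union> T)"
  let ?U' = "left_perp (F' \<union> V2)" and ?V' = "right_perp (U1 \<union> T')"
  have tp: "torsion_pair D (Obj D) (?U, ?V)" "torsion_pair D (Obj D) (?U', ?V')"
    using from_heart_in_interval[OF hp] from_heart_in_interval[OF hp']
    unfolding from_heart_def prod.case interval_iff by blast+
  have "subcategory D F'"
    using hp' additive_subcategoryD(3)[OF torsion_pairD(2), of _ T' F'] unfolding heart_pairs_iff by blast
  then have v: "Hom_vanish D T F'" "Hom_vanish D (Sh D ` T) F'"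
    using le torsion_le_iff_vanish[OF facts(3)] by blast+
  have "X \<in> ?U' \<and> Sh D X \<in> ?U'" if X: "X \<in> ?U" for X
  proof -
    obtain A B f g h where AB: "A \<in> U1" "B \<in> T" and t: "dist_triangle D A X B f g h"
      using X left_perp_subset_star[OF hp] unfolding star_def by blast
    have "orth X W \<and> orth (Sh D X) W" if W: "W \<in> F' \<union> V2" for W
    proof -
      have "W \<in> Obj D" using W facts'(4) components_Obj by blast
      moreover have "orth A W" "orth (Sh D A) W" using facts'(8,9) AB W by blast+
      moreover have "orth B W" "orth (Sh D B) W"
        using W AB facts(8,10) Hom_vanishD[OF v(1)] Hom_vanishD[OF v(2)] by blast+
      ultimately show ?thesis using orth_from_middle[OF t] orth_Sh_from_middle[OF t] by blast
    qed
    then show ?thesis using Sh_in_Obj dist_Hom(5)[OF t] unfolding left_perp_def by blast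
  qed
  then have "?U \<subseteq> ?U'" "Sh D ` ?U \<subseteq> ?U'" by blast+
  then show ?thesis unfolding from_heart_def prod.case torsion_le_iff_subset[OF tp] by blast
qed

theorem interval_heart_bijection:
  "inverse_order_bijections interval (torsion_le D) heart_pairs (torsion_le D) to_heart from_heart"
  by (rule inverse_order_bijectionsI)
    (auto simp: to_heart_in_heart_pairs from_heart_in_interval from_heart_to_heart to_heart_from_heart
      to_heart_mono from_heart_mono)

definition t_structures :: "('o set \<times> 'o set) set" where
  "t_structures = {(X, Y). t_structure D (X, Y) \<and> U1 \<subseteq> X \<and> X \<subseteq> U2}"

definition heart_s_pairs :: "('o set \<times> 'o set) set" where
  "heart_s_pairs = {(T, F). s_torsion_pair D heart (T, F) \<and>
     shift_pos D T \<subseteq> U2 \<and> shift_neg D F \<subseteq> V1}"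

text \<open>
  The defining condition of an s-torsion pair is the second half of \<open>p \<preceq> p\<close>, and the first half holds
  for every torsion pair.
\<close>

lemma heart_s_pairs_eq_reflexive: "heart_s_pairs = {p \<in> heart_pairs. torsion_le D p p}"
  unfolding heart_s_pairs_def heart_pairs_def s_torsion_pair_def torsion_le_def
  by (auto dest: torsion_pairD(3))

text \<open>
  For \<open>U\<close> closed under the shift, \<open>U1 \<subseteq> U \<subseteq> U2\<close> implies the conditions on \<open>U1[1]\<close> and \<open>U[1]\<close>.
\<close>

lemma reflexive_interval_iff:
  "(U, V) \<in> {p \<in> interval. torsion_le D p p} \<longleftrightarrow>
     torsion_pair D (Obj D) (U, V) \<and> Sh D ` U \<subseteq> U \<and> U1 \<subseteq> U \<and> U \<subseteq> U2"
proof (cases "torsion_pair D (Obj D) (U, V)")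
  case True
  then show ?thesis
    unfolding mem_Collect_eq interval_iff torsion_le_iff_subset[OF True True] by blast
qed (simp add: interval_iff)

text \<open>
  The coaisle of a t-structure is indexed from degree 0, whereas the torsion-free class consists of the
  degrees at least 1; hence the shift of the second component.
\<close>

lemma t_structures_reflexive_interval:
  "inverse_order_bijections t_structures aisle_le {p \<in> interval. torsion_le D p p} (torsion_le D)
     (map_prod id (shift_neg D)) (map_prod id (shift_pos D))"
proof (rule inverse_order_bijectionsI)
  fix p assume "p \<in> t_structures"
  then obtain X Y where p: "p = (X, Y)" "t_structure D (X, Y)" "U1 \<subseteq> X" "X \<subseteq> U2"
    unfolding t_structures_def by blast
  show "map_prod id (shift_neg D) p \<in> {p \<in> interval. torsion_le D p p}"
    using t_structure_torsion_pair[OF p(2)] p reflexive_interval_iff by simp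
  show "map_prod id (shift_pos D) (map_prod id (shift_neg D) p) = p"
    using shift_pos_shift_neg t_structure_torsion_pair(3)[OF p(2)] p(1) by simp
next
  fix p assume "p \<in> {p \<in> interval. torsion_le D p p}"
  moreover obtain U V where p: "p = (U, V)" by (cases p)
  ultimately have *: "torsion_pair D (Obj D) (U, V)" "Sh D ` U \<subseteq> U" "U1 \<subseteq> U" "U \<subseteq> U2"
    using reflexive_interval_iff by blast+
  show "map_prod id (shift_pos D) p \<in> t_structures"
    "map_prod id (shift_neg D) (map_prod id (shift_pos D) p) = p"
    using torsion_pair_t_structure[OF *(1,2)] * p unfolding t_structures_def by simp_all
next
  fix p q assume "p \<in> t_structures" "q \<in> t_structures" and le: "aisle_le p q"
  then obtain X Y X' Y' where p: "p = (X, Y)" "t_structure D (X, Y)" and q: "q = (X', Y')" "t_structure D (X', Y')"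
    unfolding t_structures_def by blast
  note tp = t_structure_torsion_pair[OF p(2)] and tq = t_structure_torsion_pair[OF q(2)]
  show "torsion_le D (map_prod id (shift_neg D) p) (map_prod id (shift_neg D) q)"
    using torsion_le_iff_subset[OF tp(1) tq(1)] tp(2) le p q unfolding aisle_le_def by auto
next
  fix p q assume "p \<in> {p \<in> interval. torsion_le D p p}" "q \<in> {p \<in> interval. torsion_le D p p}"
    and le: "torsion_le D p q"
  moreover obtain U V U' V' where pq: "p = (U, V)" "q = (U', V')" by (cases p, cases q)
  ultimately have "torsion_pair D (Obj D) (U, V)" "torsion_pair D (Obj D) (U', V')"
    using interval_iff by blast+
  then have "U \<subseteq> U'" using torsion_le_iff_subset le pq by blast
  then show "aisle_le (map_prod id (shift_pos D) p) (map_prod id (shift_pos D) q)"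
    unfolding aisle_le_def pq by simp
qed

theorem t_structures_heart_bijection:
  "inverse_order_bijections t_structures aisle_le heart_s_pairs (torsion_le D)
     (to_heart \<circ> map_prod id (shift_neg D)) (map_prod id (shift_pos D) \<circ> from_heart)"
  unfolding heart_s_pairs_eq_reflexive
  using inverse_order_bijections_comp[OF t_structures_reflexive_interval
      inverse_order_bijections_reflexive_part[OF interval_heart_bijection]] .

end

text \<open>
  Aisles are closed under \<open>[1]\<close>. So for \<open>X1 \<subseteq> U \<subseteq> X2\<close> the inclusions \<open>X1[1] \<subseteq> U\<close> and \<open>U[1] \<subseteq> X2\<close> follow, and
  every torsion pair \<open>(T, F)\<close> in the heart satisfies \<open>T[1] \<subseteq> X2[1] \<subseteq> X2\<close> and the dual condition on \<open>F[-1]\<close>.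
\<close>

locale t_structure_interval = triangulated_category D
  for D :: "('o, 'm, 'x) triangulated_data_scheme" (structure) +
  fixes X1 Y1 X2 Y2 :: "'o set"
  assumes t1: "t_structure D (X1, Y1)" and t2: "t_structure D (X2, Y2)" and X1_X2: "X1 \<subseteq> X2"
begin

sublocale torsion_interval D X1 "shift_neg D Y1" X2 "shift_neg D Y2"
proof
  note 1 = t_structure_torsion_pair[OF t1] and 2 = t_structure_torsion_pair[OF t2]
  show "torsion_pair D (Obj D) (X1, shift_neg D Y1)" "torsion_pair D (Obj D) (X2, shift_neg D Y2)"
    by (fact 1(1), fact 2(1))
  show "torsion_le D (X1, shift_neg D Y1) (X2, shift_neg D Y2)"
    using torsion_le_iff_subset[OF 1(1) 2(1)] X1_X2 1(2) by blast
qed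

lemma interval_eq:
  "interval = {(U, V). torsion_pair D (Obj D) (U, V) \<and> X1 \<subseteq> U \<and> U \<subseteq> X2}"
proof -
  have "(U, V) \<in> interval \<longleftrightarrow> torsion_pair D (Obj D) (U, V) \<and> X1 \<subseteq> U \<and> U \<subseteq> X2" for U V
    unfolding interval_iff using t_structure_torsion_pair(2)[OF t1] t_structure_torsion_pair(2)[OF t2] by blast
  then show ?thesis by auto
qed

lemma heart_pairs_eq_torsion_pairs: "heart_pairs = {(T, F). torsion_pair D heart (T, F)}"
proof -
  have "(T, F) \<in> heart_pairs" if tp: "torsion_pair D heart (T, F)" for T F
  proof -
    have "T \<subseteq> X2" "F \<subseteq> shift_neg D Y1"
      using additive_subcategoryD(1)[OF torsion_pairD(1)[OF tp]]
        additive_subcategoryD(1)[OF torsion_pairD(2)[OF tp]] by blast+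
    moreover have "Hom_vanish D (Sh D ` X1) (shift_neg D Y1)"
      using t_structure_torsion_pair[OF t1] torsion_pairD(3) unfolding Hom_vanish_def by blast
    ultimately show ?thesis
      unfolding heart_pairs_iff using tp t_structure_torsion_pair(2)[OF t2]
      unfolding Hom_vanish_def by blast
  qed
  then show ?thesis unfolding heart_pairs_def by auto
qed

lemma heart_s_pairs_eq_s_torsion_pairs: "heart_s_pairs = {(T, F). s_torsion_pair D heart (T, F)}"
proof -
  have "shift_pos D T \<subseteq> X2 \<and> shift_neg D F \<subseteq> shift_neg D Y1"
    if "torsion_pair D heart (T, F)" for T F
    using that eqset_imp_iff[OF heart_pairs_eq_torsion_pairs, of "(T, F)"] unfolding heart_pairs_def by simp
  then show ?thesis unfolding heart_s_pairs_def s_torsion_pair_def by auto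
qed

end

theorem corollary1p2:
  fixes D :: "('o, 'm) triangulated_data"
    and U1 V1 U2 V2 C1le C1ge C2le C2ge :: "'o set"
  assumes "triangulated_category D"
    and "torsion_pair D (Obj D) (U1, V1)"
    and "torsion_pair D (Obj D) (U2, V2)"
    and "torsion_le D (U1, V1) (U2, V2)"
    and "t_structure D (C1le, C1ge)"
    and "t_structure D (C2le, C2ge)"
    and "C1le \<subseteq> C2le"
  shows
    "(\<exists>\<phi> \<psi>. inverse_order_bijections
        {(U, V). torsion_pair D (Obj D) (U, V) \<and>
                 torsion_le D (U1, V1) (U, V) \<and> torsion_le D (U, V) (U2, V2)}
        (torsion_le D)
        {(T, F). torsion_pair D (U2 \<inter> V1) (T, F) \<and>
                 shift_pos D T \<subseteq> U2 \<and> shift_neg D F \<subseteq> V1}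
        (torsion_le D) \<phi> \<psi>) \<and>
     (\<exists>\<phi> \<psi>. inverse_order_bijections
        {(Dle, Dge). t_structure D (Dle, Dge) \<and> U1 \<subseteq> Dle \<and> Dle \<subseteq> U2}
        aisle_le
        {(T, F). s_torsion_pair D (U2 \<inter> V1) (T, F) \<and>
                 shift_pos D T \<subseteq> U2 \<and> shift_neg D F \<subseteq> V1}
        (torsion_le D) \<phi> \<psi>) \<and>
     (\<exists>\<phi> \<psi>. inverse_order_bijections
        {(U, V). torsion_pair D (Obj D) (U, V) \<and> C1le \<subseteq> U \<and> U \<subseteq> C2le}
        (torsion_le D)
        {(T, F). torsion_pair D (C2le \<inter> shift_neg D C1ge) (T, F)}
        (torsion_le D) \<phi> \<psi>) \<and>
     (\<exists>\<phi> \<psi>. inverse_order_bijections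
        {(Dle, Dge). t_structure D (Dle, Dge) \<and> C1le \<subseteq> Dle \<and> Dle \<subseteq> C2le}
        aisle_le
        {(T, F). s_torsion_pair D (C2le \<inter> shift_neg D C1ge) (T, F)}
        (torsion_le D) \<phi> \<psi>)"
proof -
  interpret torsion_interval D U1 V1 U2 V2
    by (intro torsion_interval.intro torsion_interval_axioms.intro assms)
  interpret C: t_structure_interval D C1le C1ge C2le C2ge
    by (intro t_structure_interval.intro t_structure_interval_axioms.intro assms)
  show ?thesis
    using interval_heart_bijection[unfolded interval_def heart_pairs_def]
      t_structures_heart_bijection[unfolded t_structures_def heart_s_pairs_def]
      C.interval_heart_bijection[unfolded C.interval_eq C.heart_pairs_eq_torsion_pairs]
      C.t_structures_heart_bijection[unfolded C.t_structures_def C.heart_s_pairs_eq_s_torsion_pairs]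
    by blast
qed

end
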